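(* Fix $n\ge2$ and consider the partition $\theta=(2,1,1,\dots,1,0)$ with $n-1$ nonzero parts and $|\theta|=n$. For $k\ge0$, let $\mathcal{C}_k$ denote the set of column strict fillings $F$ of shape $k\theta$ with entries in $[n]=\{1,\dots,n\}$ with the property that either $1$ occurs in the first column of $F$ or $1$ does not occur in its last column. Then $$\sum_{k\ge0}\ \sum_{F\in\mathcal{C}_k}x^F\,q^{k^2-\mathrm{inv}(F)}$$ equals the character of the basic representation $L(\Lambda_0)$ of the affine Lie algebra $\widehat{\mathfrak{sl}_n}$.
   Context: The Young diagram of a partition is drawn in English convention (row $i$ from the top has as many cells as the $i$-th part, left-justified). A column strict filling of shape $\lambda$ is a map $F:\mathrm{dg}(\lambda)\to[n]$ whose values strictly increase going down each column (no condition on rows); $x^F=\prod_{c\in\mathrm{dg}(\lambda)}x_{F(c)}$. The "or" in the definition of $\mathcal{C}_k$ is inclusive; $\mathcal{C}_0$ consists of the empty filling, contributing $1$. $\mathrm{inv}(F)$ is the Haglund-Haiman-Loehr statistic, in English convention: two cells attack each other if they are in the same row, or are in rows $i$ and $i+1$ with the cell in row $i+1$ in a column strictly to the right of that of the cell in row $i$. The reading order goes through the rows from the lowest row to the top row, left to right in each row. $\mathrm{Inv}(F)$ is the set of pairs of attacking cells $\{u,w\}$ with $u$ preceding $w$ in reading order and $F(u)>F(w)$. $\mathrm{Des}(F)$ is the set of cells $u$ not in the top row with $F(u)$ greater than the entry of the cell immediately above $u$. $\mathrm{arm}(u)$ is the number of cells strictly to the right of $u$ in its row. Then $\mathrm{inv}(F)=|\mathrm{Inv}(F)|-\sum_{u\in\mathrm{Des}(F)}\mathrm{arm}(u)$.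 Character conventions: $x_i$ is the formal exponential of the $i$-th coordinate weight of $\mathfrak{sl}_n$, so the identity is understood modulo the relation $x_1x_2\cdots x_n=1$; $q=e^{-\delta}$, where $\delta$ is the null root; and the character is normalized by $e^{\Lambda_0}=1$ (the highest weight vector contributes $1$). With these conventions, by the standard formula, the character of $L(\Lambda_0)$ is $\prod_{m\ge1}(1-q^m)^{-(n-1)}\sum_{\gamma}q^{\frac12\sum_i\gamma_i^2}x_1^{\gamma_1}\cdots x_n^{\gamma_n}$, the sum being over $\gamma\in\mathbb{Z}^n$ with $\gamma_1+\cdots+\gamma_n=0$. *)

theory Defs
  imports
    "HOL-Library.FuncSet"
    "HOL-Library.Poly_Mapping"
    "HOL-Computational_Algebra.Formal_Laurent_Series"
    "HOL-Analysis.Infinite_Sum"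
    "HOL-Analysis.Infinite_Products"
begin

section \<open>Fillings of Young diagrams\<close>

text \<open>
  A partition is a list of parts. Cells are pairs (row, column) in English convention, both
  counted from 0, so that row 0 is the top row and column 0 is the first column.
\<close>

definition dg :: "nat list \<Rightarrow> (nat \<times> nat) set" where
  "dg \<mu> = {(i, j). i < length \<mu> \<and> j < \<mu> ! i}"

definition column_strict_fillings :: "nat list \<Rightarrow> nat \<Rightarrow> (nat \<times> nat \<Rightarrow> nat) set" where
  "column_strict_fillings \<mu> n =
     {F \<in> dg \<mu> \<rightarrow>\<^sub>E {1..n}.
        \<forall>i i' j. (i, j) \<in> dg \<mu> \<longrightarrow> (i', j) \<in> dg \<mu> \<longrightarrow> i < i' \<longrightarrow> F (i, j) < F (i', j)}"

definition attack :: "nat \<times> nat \<Rightarrow> nat \<times> nat \<Rightarrow> bool" where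
  "attack u w \<longleftrightarrow>
     fst u = fst w \<and> u \<noteq> w \<or>
     fst w = fst u + 1 \<and> snd u < snd w \<or>
     fst u = fst w + 1 \<and> snd w < snd u"

definition precedes :: "nat \<times> nat \<Rightarrow> nat \<times> nat \<Rightarrow> bool" where
  "precedes u w \<longleftrightarrow> fst w < fst u \<or> fst u = fst w \<and> snd u < snd w"

text \<open>
  An unordered pair of attacking cells is represented by the ordered pair in which the cell that
  comes first in reading order is listed first.
\<close>

definition Inv :: "nat list \<Rightarrow> (nat \<times> nat \<Rightarrow> nat) \<Rightarrow> ((nat \<times> nat) \<times> (nat \<times> nat)) set" where
  "Inv \<mu> F = {(u, w). u \<in> dg \<mu> \<and> w \<in> dg \<mu> \<and> attack u w \<and> precedes u w \<and> F w < F u}"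

definition Des :: "nat list \<Rightarrow> (nat \<times> nat \<Rightarrow> nat) \<Rightarrow> (nat \<times> nat) set" where
  "Des \<mu> F = {(i, j). (i, j) \<in> dg \<mu> \<and> 0 < i \<and> F (i - 1, j) < F (i, j)}"

definition arm :: "nat list \<Rightarrow> nat \<times> nat \<Rightarrow> nat" where
  "arm \<mu> u = card {j. snd u < j \<and> (fst u, j) \<in> dg \<mu>}"

definition inv_stat :: "nat list \<Rightarrow> (nat \<times> nat \<Rightarrow> nat) \<Rightarrow> int" where
  "inv_stat \<mu> F = int (card (Inv \<mu> F)) - (\<Sum>u\<in>Des \<mu> F. int (arm \<mu> u))"

definition theta :: "nat \<Rightarrow> nat list" where
  "theta n = 2 # replicate (n - 2) 1 @ [0]"

definition k_theta :: "nat \<Rightarrow> nat \<Rightarrow> nat list" where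
  "k_theta n k = map ((*) k) (theta n)"

text \<open>
  The number of columns is the first part. For \<open>k = 0\<close> there are no columns, hence the second
  disjunct holds and the empty filling belongs to the set.
\<close>

definition C_fillings :: "nat \<Rightarrow> nat \<Rightarrow> (nat \<times> nat \<Rightarrow> nat) set" where
  "C_fillings n k =
     {F \<in> column_strict_fillings (k_theta n k) n.
        (\<exists>i. (i, 0) \<in> dg (k_theta n k) \<and> F (i, 0) = 1) \<or>
        \<not> (\<exists>i j. j + 1 = hd (k_theta n k) \<and> (i, j) \<in> dg (k_theta n k) \<and> F (i, j) = 1)}"


lemma finite_C_fillings: "finite (C_fillings n k)"
proof (rule finite_subset)
  have "dg \<mu> \<subseteq> (\<Union>i<length \<mu>. {i} \<times> {..<\<mu> ! i})" for \<mu> :: "nat list"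
    by (auto simp: dg_def)
  then have "finite (dg \<mu>)" for \<mu> :: "nat list"
    by (rule finite_subset) auto
  then show "finite (dg (k_theta n k) \<rightarrow>\<^sub>E {1..n})"
    by (intro finite_PiE) auto
qed (auto simp: C_fillings_def column_strict_fillings_def)


section \<open>Formal exponentials of weights\<close>

text \<open>
  An integral weight of \<open>sl\<^sub>n\<close> is given by its coordinates in the basis of fundamental weights
  \<open>\<omega>\<^sub>1, \<dots>, \<omega>\<^sub>n\<^sub>-\<^sub>1\<close>. The coordinate weights are \<open>\<epsilon>\<^sub>i = \<omega>\<^sub>i - \<omega>\<^sub>i\<^sub>-\<^sub>1\<close>
  with \<open>\<omega>\<^sub>0 = \<omega>\<^sub>n = 0\<close>. Formal exponentials live in the group ring of the weight lattice.
  The lemmas \<open>weight_eq_iff\<close> and \<open>prod_x\<close> say that this is the quotient by the relation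
  \<open>x\<^sub>1 x\<^sub>2 \<cdots> x\<^sub>n = 1\<close> and nothing more.
\<close>

type_synonym weight = "nat \<Rightarrow>\<^sub>0 int"

definition coord_weight :: "nat \<Rightarrow> nat \<Rightarrow> weight" where
  "coord_weight n i = (if i < n then Poly_Mapping.single i 1 else 0)
           - (if 1 < i then Poly_Mapping.single (i - 1) 1 else 0)"

definition x_var :: "nat \<Rightarrow> nat \<Rightarrow> weight \<Rightarrow>\<^sub>0 int" where
  "x_var n i = Poly_Mapping.single (coord_weight n i) 1"

text \<open>The weight of the Laurent monomial \<open>x\<^sub>1\<^bsup>\<gamma>\<^sub>1\<^esup> \<cdots> x\<^sub>n\<^bsup>\<gamma>\<^sub>n\<^esup>\<close>, and that monomial itself.\<close>

definition weight_of :: "nat \<Rightarrow> (nat \<Rightarrow> int) \<Rightarrow> weight" where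
  "weight_of n \<gamma> = (\<Sum>i=1..n. frag_cmul (\<gamma> i) (coord_weight n i))"

definition x_monomial :: "nat \<Rightarrow> (nat \<Rightarrow> int) \<Rightarrow> weight \<Rightarrow>\<^sub>0 int" where
  "x_monomial n \<gamma> = Poly_Mapping.single (weight_of n \<gamma>) 1"

definition x_filling :: "nat \<Rightarrow> nat list \<Rightarrow> (nat \<times> nat \<Rightarrow> nat) \<Rightarrow> weight \<Rightarrow>\<^sub>0 int" where
  "x_filling n \<mu> F = (\<Prod>c\<in>dg \<mu>. x_var n (F c))"

lemma lookup_weight_of:
  assumes "n \<ge> 2"
  shows "Poly_Mapping.lookup (weight_of n \<gamma>) i =
           (if 1 \<le> i \<and> i < n then \<gamma> i - \<gamma> (i + 1) else 0)"
proof -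
  have lookup_coord_weight: "Poly_Mapping.lookup (coord_weight n j) i =
      (if j = i \<and> i < n then 1 else 0) - (if j = i + 1 \<and> 1 \<le> i then 1 else 0)" if "j \<ge> 1" for j
    using that by (auto simp: coord_weight_def lookup_minus lookup_single when_def)
  have "Poly_Mapping.lookup (weight_of n \<gamma>) i =
          (\<Sum>j=1..n. \<gamma> j * Poly_Mapping.lookup (coord_weight n j) i)"
    by (simp add: weight_of_def lookup_sum)
  also have "\<dots> = (\<Sum>j=1..n. (if j = i then (if i < n then \<gamma> j else 0) else 0)
                    - (if j = i + 1 then (if 1 \<le> i then \<gamma> j else 0) else 0))"
    by (intro sum.cong refl) (auto simp: lookup_coord_weight)
  also have "\<dots> = (if 1 \<le> i \<and> i < n then \<gamma> i - \<gamma> (i + 1) else 0)"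
    by (simp only: sum_subtractf sum.delta finite_atLeastAtMost) auto
  finally show ?thesis .
qed

lemma weight_eq_iff:
  assumes "n \<ge> 2"
  shows "weight_of n \<gamma> = weight_of n \<gamma>' \<longleftrightarrow> (\<exists>c. \<forall>i\<in>{1..n}. \<gamma> i = \<gamma>' i + c)"
proof
  assume eq: "weight_of n \<gamma> = weight_of n \<gamma>'"
  have step: "\<gamma> i - \<gamma>' i = \<gamma> (i + 1) - \<gamma>' (i + 1)" if "1 \<le> i" "i < n" for i
    using arg_cong[OF eq, of "\<lambda>w. Poly_Mapping.lookup w i"] that
    by (simp add: lookup_weight_of[OF assms])
  have "i \<le> n \<longrightarrow> \<gamma> i - \<gamma>' i = \<gamma> 1 - \<gamma>' 1" if "1 \<le> i" for i
    using that
  proof (induction i rule: dec_induct)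
    case base
    show ?case by simp
  next
    case (step i)
    with \<open>\<And>i. \<lbrakk>1 \<le> i; i < n\<rbrakk> \<Longrightarrow> \<gamma> i - \<gamma>' i = \<gamma> (i + 1) - \<gamma>' (i + 1)\<close>[of i] show ?case by auto
  qed
  then have "\<forall>i\<in>{1..n}. \<gamma> i = \<gamma>' i + (\<gamma> 1 - \<gamma>' 1)"
    by (force simp: algebra_simps)
  then show "\<exists>c. \<forall>i\<in>{1..n}. \<gamma> i = \<gamma>' i + c" by blast
next
  assume "\<exists>c. \<forall>i\<in>{1..n}. \<gamma> i = \<gamma>' i + c"
  then show "weight_of n \<gamma> = weight_of n \<gamma>'"
    by (auto intro!: poly_mapping_eqI simp: lookup_weight_of[OF assms])
qed

lemma prod_x_power:
  "(\<Prod>i=1..n. x_var n i ^ \<gamma> i) = x_monomial n (\<lambda>i. int (\<gamma> i))"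
proof -
  have pow: "x_var n i ^ k = Poly_Mapping.single (frag_cmul (int k) (coord_weight n i)) 1" for i k
    by (induction k) (simp_all add: x_var_def mult_single frag_cmul_distrib add.commute)
  have "(\<Prod>i\<in>A. Poly_Mapping.single (f i) (1::int)) = Poly_Mapping.single (\<Sum>i\<in>A. f i) 1"
    if "finite A" for A :: "nat set" and f :: "nat \<Rightarrow> weight"
    using that by induction (simp_all add: mult_single)
  then show ?thesis
    by (simp add: pow x_monomial_def weight_of_def)
qed

lemma prod_x:
  assumes "n \<ge> 2"
  shows "(\<Prod>i=1..n. x_var n i) = 1"
proof -
  have "weight_of n (\<lambda>i. 1) = 0"
    by (auto intro!: poly_mapping_eqI simp: lookup_weight_of[OF assms])
  then show ?thesis
    using prod_x_power[of n "\<lambda>i. 1"] by (simp add: x_monomial_def)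
qed


section \<open>The character of the basic representation\<close>

text \<open>
  Power series in \<open>q = e\<^bsup>-\<delta>\<^esup>\<close> over the group ring. Since the latter has no division operation,
  \<open>(1 - q\<^sup>m)\<^sup>-\<^sup>1\<close> is written with \<^const>\<open>fps_right_inverse_constructor\<close>; the second argument is
  the inverse of the constant coefficient. The convergence of the product and of the sum
  in the \<open>q\<close>-adic topology is shown below.
\<close>

definition euler_factor :: "nat \<Rightarrow> (weight \<Rightarrow>\<^sub>0 int) fps" where
  "euler_factor m = fps_right_inverse (1 - fps_X ^ m) 1"

text \<open>The exponent \<open>1/2 \<Sum>\<^sub>i \<gamma>\<^sub>i\<^sup>2\<close> is an integer because \<open>\<Sum>\<^sub>i \<gamma>\<^sub>i = 0\<close>, see \<open>half_norm\<close>.\<close>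

definition root_lattice :: "nat \<Rightarrow> (nat \<Rightarrow> int) set" where
  "root_lattice n = {\<gamma> \<in> {1..n} \<rightarrow>\<^sub>E UNIV. (\<Sum>i=1..n. \<gamma> i) = 0}"

definition half_norm :: "nat \<Rightarrow> (nat \<Rightarrow> int) \<Rightarrow> nat" where
  "half_norm n \<gamma> = nat ((\<Sum>i=1..n. (\<gamma> i)\<^sup>2) div 2)"

text \<open>
  The character of \<open>L(\<Lambda>\<^sub>0)\<close>, normalized by \<open>e\<^bsup>\<Lambda>\<^sub>0\<^esup> = 1\<close>, as given by the standard
  (Frenkel--Kac) formula: the theta series of the root lattice divided by
  \<open>\<Prod>\<^sub>m (1 - q\<^sup>m)\<^bsup>n-1\<^esup>\<close>.
\<close>

definition basic_character :: "nat \<Rightarrow> (weight \<Rightarrow>\<^sub>0 int) fps" where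
  "basic_character n =
     prodinf (\<lambda>m. euler_factor (m + 1) ^ (n - 1)) *
     (\<Sum>\<^sub>\<infinity>\<gamma>\<in>root_lattice n. fps_X ^ half_norm n \<gamma> * fps_const (x_monomial n \<gamma>))"

lemma euler_factor:
  assumes "m \<ge> 1"
  shows "(1 - fps_X ^ m) * euler_factor m = 1"
  unfolding euler_factor_def using assms by (intro fps_right_inverse) simp

lemma half_norm:
  assumes "\<gamma> \<in> root_lattice n"
  shows "2 * int (half_norm n \<gamma>) = (\<Sum>i=1..n. (\<gamma> i)\<^sup>2)"
proof -
  have "even (\<Sum>i\<in>A. (\<gamma> i)\<^sup>2) \<longleftrightarrow> even (\<Sum>i\<in>A. \<gamma> i)" if "finite A" for A :: "nat set"
    using that by induction auto
  from this[of "{1..n}"] have "even (\<Sum>i=1..n. (\<gamma> i)\<^sup>2)"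
    using assms by (simp add: root_lattice_def)
  moreover have "(\<Sum>i=1..n. (\<gamma> i)\<^sup>2) \<ge> 0" by (intro sum_nonneg) simp
  ultimately show ?thesis by (simp add: half_norm_def)
qed

lemma finite_half_norm: "finite {\<gamma> \<in> root_lattice n. half_norm n \<gamma> \<le> N}"
proof (rule finite_subset)
  show "{\<gamma> \<in> root_lattice n. half_norm n \<gamma> \<le> N} \<subseteq> {1..n} \<rightarrow>\<^sub>E {- 2 * int N..2 * int N}"
  proof
    fix \<gamma> assume "\<gamma> \<in> {\<gamma> \<in> root_lattice n. half_norm n \<gamma> \<le> N}"
    then have \<gamma>: "\<gamma> \<in> root_lattice n" "half_norm n \<gamma> \<le> N" by auto
    have "\<bar>\<gamma> i\<bar> \<le> 2 * int N" if "i \<in> {1..n}" for i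
    proof -
      have "\<bar>\<gamma> i\<bar> \<le> (\<gamma> i)\<^sup>2"
        using self_le_power[of "\<bar>\<gamma> i\<bar>" 2] by (cases "\<gamma> i = 0") auto
      also have "\<dots> \<le> (\<Sum>i=1..n. (\<gamma> i)\<^sup>2)"
        using that by (intro member_le_sum) auto
      also have "\<dots> = 2 * int (half_norm n \<gamma>)"
        using half_norm[OF \<gamma>(1)] by simp
      finally show ?thesis using \<gamma>(2) by simp
    qed
    then show "\<gamma> \<in> {1..n} \<rightarrow>\<^sub>E {- 2 * int N..2 * int N}"
      using \<gamma>(1) by (auto simp: root_lattice_def PiE_iff abs_le_iff) (smt (verit))+
  qed
qed (auto intro: finite_PiE)

lemma summable_basic_character:
  "(\<lambda>\<gamma>. fps_X ^ half_norm n \<gamma> * fps_const (x_monomial n \<gamma>)) summable_on root_lattice n"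
proof -
  define f where "f \<gamma> = fps_X ^ half_norm n \<gamma> * fps_const (x_monomial n \<gamma>)" for \<gamma>
  define B where "B N = {\<gamma> \<in> root_lattice n. half_norm n \<gamma> \<le> N}" for N
  have f_nth: "fps_nth (f \<gamma>) d = (if d = half_norm n \<gamma> then x_monomial n \<gamma> else 0)" for \<gamma> d
    by (simp add: f_def fps_X_power_mult_nth)
  have "(sum f \<longlongrightarrow> Abs_fps (\<lambda>d. \<Sum>\<gamma>\<in>B d. fps_nth (f \<gamma>) d))
          (finite_subsets_at_top (root_lattice n))"
    unfolding tendsto_fps_iff
  proof
    fix d
    have "fps_nth (sum f Y) d = (\<Sum>\<gamma>\<in>B d. fps_nth (f \<gamma>) d)"
      if "finite Y" "B d \<subseteq> Y" "Y \<subseteq> root_lattice n" for Y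
      unfolding fps_sum_nth using that
      by (intro sum.mono_neutral_right) (auto simp: B_def f_nth)
    then show "\<forall>\<^sub>F Y in finite_subsets_at_top (root_lattice n).
        fps_nth (sum f Y) d = fps_nth (Abs_fps (\<lambda>d. \<Sum>\<gamma>\<in>B d. fps_nth (f \<gamma>) d)) d"
      unfolding eventually_finite_subsets_at_top
      by (intro exI[of _ "B d"]) (use finite_half_norm in \<open>auto simp: B_def\<close>)
  qed
  then show ?thesis
    unfolding has_sum_def[symmetric] f_def[abs_def] by (rule has_sum_imp_summable)
qed

lemma convergent_prod_basic_character: "convergent_prod (\<lambda>m. euler_factor (m + 1) ^ (n - 1))"
proof -
  define f where "f m = euler_factor (m + 1) ^ (n - 1)" for m
  have "fps_cutoff (m + 1) (euler_factor (m + 1)) = 1" for m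
  proof -
    have "fps_cutoff (m + 1) (euler_factor (m + 1)) =
            fps_cutoff (m + 1) (1 + fps_X ^ (m + 1) * euler_factor (m + 1))"
      using euler_factor[of "m + 1"] by (simp add: algebra_simps)
    also have "\<dots> = 1"
      by (rule fps_ext) (simp only: fps_cutoff_nth fps_add_nth fps_X_power_mult_nth, auto)
    finally show ?thesis .
  qed
  then have e0: "fps_nth (euler_factor (m + 1)) d = (if d = 0 then 1 else 0)" if "d \<le> m" for m d
    using that by (metis fps_cutoff_nth fps_one_nth le_imp_less_Suc Suc_eq_plus1)
  have low: "fps_nth (g * h) d = fps_nth g d"
    if "\<And>j. j \<le> d \<Longrightarrow> fps_nth h j = (if j = 0 then 1 else 0)" for g h :: "(weight \<Rightarrow>\<^sub>0 int) fps" and d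
  proof -
    have "fps_nth (g * h) d = (\<Sum>i=0..d. if i = d then fps_nth g d else 0)"
      unfolding fps_mult_nth by (intro sum.cong refl) (use that in auto)
    then show ?thesis by simp
  qed
  have f0: "fps_nth (f m) d = (if d = 0 then 1 else 0)" if "d \<le> m" for m d
  proof -
    have "fps_nth (euler_factor (m + 1) ^ k) d = (if d = 0 then 1 else 0)" for k
    proof (induction k)
      case (Suc k)
      have "fps_nth (euler_factor (m + 1) ^ Suc k) d = fps_nth (euler_factor (m + 1) ^ k) d"
        unfolding power_Suc2 by (rule low) (use e0 that in simp)
      with Suc show ?case by simp
    qed simp
    then show ?thesis by (simp add: f_def)
  qed
  define P where "P N = (\<Prod>i\<le>N. f i)" for N
  have stable: "fps_nth (P N) d = fps_nth (P d) d" if "d \<le> N" for N d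
    using that
  proof (induction N rule: dec_induct)
    case (step N)
    have "fps_nth (P (Suc N)) d = fps_nth (P N) d"
      unfolding P_def prod.atMost_Suc using step by (intro low f0) auto
    with step show ?case by simp
  qed simp
  define p where "p = Abs_fps (\<lambda>d. fps_nth (P d) d)"
  have "P \<longlonglongrightarrow> p"
    unfolding tendsto_fps_iff p_def
    by (auto intro!: eventually_sequentiallyI stable)
  moreover have "fps_nth p 0 = 1"
    by (simp add: p_def P_def f0)
  then have "p \<noteq> 0" by auto
  ultimately have "raw_has_prod f 0 p"
    by (simp add: raw_has_prod_def P_def[abs_def])
  then show ?thesis
    unfolding convergent_prod_def f_def[abs_def] by blast
qed

end

theory Submission
  imports Defs
begin

text \<open>
  A column strict filling of shape \<open>k\<theta>\<close> is a pair of words \<open>a, b\<close> of length \<open>k\<close>: the entries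
  missing from the long columns, and the top row entries of the short columns (read from the right).
  In these terms \<open>inv = asc a + asc b + \<alpha>\<^sub>1 \<beta>\<^sub>1\<close>, where \<open>\<alpha>, \<beta>\<close> are the contents of \<open>a, b\<close>, and
  \<open>asc\<close> and \<open>desc\<close> count the (not necessarily adjacent) increasing and decreasing pairs of
  letters. The fillings outside \<open>C\<^sub>k\<close> are those where both words start with \<open>1\<close>; deleting the two ones changes
  neither the weight nor \<open>k\<^sup>2 - inv\<close>, so the series telescopes and its partial sums run over all
  fillings of shape \<open>k\<theta>\<close>. Since \<open>k\<^sup>2 - inv = 1/2 |\<beta> - \<alpha>|\<^sup>2 + \<Sum>\<^sub>i\<^sub>\<ge>\<^sub>2 \<alpha>\<^sub>i \<beta>\<^sub>i + desc a + desc b\<close>,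
  MacMahon's theorem on inversions of words turns the coefficient of \<open>x\<^sup>\<gamma>\<close> into a sum of
  products of \<open>q\<close>-multinomial coefficients. For \<open>k \<rightarrow> \<infinity>\<close> it becomes \<open>q\<close> to the power
  \<open>1/2 |\<gamma>|\<^sup>2\<close> times the product over \<open>i \<ge> 2\<close> of
  \<open>\<Sum>\<^sub>m q\<^bsup>m(m+\<gamma>\<^sub>i)\<^esup> / ((q)\<^sub>m (q)\<^bsub>m+\<gamma>\<^sub>i\<^esub>)\<close>, and each of these sums is \<open>1/(q)\<^sub>\<infinity>\<close> by the Durfee
  rectangle identity.
\<close>

section \<open>Power series modulo a power of the variable\<close>

text \<open>Congruence modulo \<open>X^(d+1)\<close>: degree \<open>d\<close> itself is included.
  Convergence of power series is eventual agreement for every \<open>d\<close>, so the limits below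
  reduce to such congruences.\<close>

definition fps_agree :: "nat \<Rightarrow> 'a::zero fps \<Rightarrow> 'a fps \<Rightarrow> bool" where
  "fps_agree d f g \<longleftrightarrow> (\<forall>i\<le>d. fps_nth f i = fps_nth g i)"

lemma fps_agree_refl [simp]: "fps_agree d f f"
  by (simp add: fps_agree_def)

lemma fps_agree_sym: "fps_agree d f g \<Longrightarrow> fps_agree d g f"
  by (simp add: fps_agree_def)

lemma fps_agree_trans [trans]: "fps_agree d f g \<Longrightarrow> fps_agree d g h \<Longrightarrow> fps_agree d f h"
  by (simp add: fps_agree_def)

lemma fps_agree_add:
  "fps_agree d f g \<Longrightarrow> fps_agree d f' g' \<Longrightarrow> fps_agree d (f + f') (g + g' :: 'a::comm_ring_1 fps)"
  by (simp add: fps_agree_def)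

lemma fps_agree_mult:
  "fps_agree d f g \<Longrightarrow> fps_agree d f' g' \<Longrightarrow> fps_agree d (f * f') (g * g' :: 'a::comm_ring_1 fps)"
  by (auto simp: fps_agree_def fps_mult_nth intro!: sum.cong)

lemma fps_agree_power:
  "fps_agree d f g \<Longrightarrow> fps_agree d (f ^ k) (g ^ k :: 'a::comm_ring_1 fps)"
  by (induction k) (auto intro: fps_agree_mult)

lemma fps_agree_sum:
  "(\<And>x. x \<in> A \<Longrightarrow> fps_agree d (f x) (g x)) \<Longrightarrow>
     fps_agree d (\<Sum>x\<in>A. f x) (\<Sum>x\<in>A. g x :: 'a::comm_ring_1 fps)"
  by (auto simp: fps_agree_def fps_sum_nth intro!: sum.cong)

lemma fps_agree_prod:
  "(\<And>x. x \<in> A \<Longrightarrow> fps_agree d (f x) (g x)) \<Longrightarrow>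
     fps_agree d (\<Prod>x\<in>A. f x) (\<Prod>x\<in>A. g x :: 'a::comm_ring_1 fps)"
  by (induction A rule: infinite_finite_induct) (auto intro: fps_agree_mult)

lemma fps_agree_X_power_mult:
  "d < m \<Longrightarrow> fps_agree d (fps_X ^ m * f :: 'a::comm_ring_1 fps) 0"
  by (simp add: fps_agree_def fps_X_power_mult_nth)

lemma fps_agree_sum_neutral:
  assumes "finite B" "A \<subseteq> B" "\<And>x. x \<in> B - A \<Longrightarrow> fps_agree d (f x) 0"
  shows "fps_agree d (\<Sum>x\<in>B. f x) (\<Sum>x\<in>A. f x :: 'a::comm_ring_1 fps)"
  unfolding fps_agree_def fps_sum_nth using assms
  by (auto simp: fps_agree_def intro!: sum.mono_neutral_right)

section \<open>The q-Pochhammer symbols (q)_m and their inverses\<close>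

definition qpoch :: "nat \<Rightarrow> 'a::comm_ring_1 fps" where
  "qpoch m = (\<Prod>i<m. 1 - fps_X ^ Suc i)"

text \<open>The coefficients will lie in a group ring, which has no division, so the inverse is
  assembled factor by factor, in the same form as \<open>euler_factor\<close>.\<close>

definition qpoch_inv :: "nat \<Rightarrow> 'a::comm_ring_1 fps" where
  "qpoch_inv m = (\<Prod>i<m. fps_right_inverse (1 - fps_X ^ Suc i) 1)"

lemma geometric_right_inverse:
  "(1 - fps_X ^ Suc i) * fps_right_inverse (1 - fps_X ^ Suc i) 1 = (1 :: 'a::comm_ring_1 fps)"
  by (intro fps_right_inverse) simp

lemma qpoch_mult_inv: "qpoch m * qpoch_inv m = (1 :: 'a::comm_ring_1 fps)"
  unfolding qpoch_def qpoch_inv_def prod.distrib[symmetric] by (simp only: geometric_right_inverse prod.neutral_const)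

lemma qpoch_0 [simp]: "qpoch 0 = 1" and qpoch_Suc: "qpoch (Suc m) = qpoch m * (1 - fps_X ^ Suc m)"
  by (simp_all add: qpoch_def)

lemma qpoch_inv_Suc: "qpoch_inv m = qpoch_inv (Suc m) * (1 - fps_X ^ Suc m :: 'a::comm_ring_1 fps)"
proof -
  have "qpoch_inv (Suc m) * (1 - fps_X ^ Suc m :: 'a fps) =
      qpoch_inv m * ((1 - fps_X ^ Suc m) * fps_right_inverse (1 - fps_X ^ Suc m) 1)"
    unfolding qpoch_inv_def prod.lessThan_Suc by (simp only: mult_ac)
  then show ?thesis by (simp only: geometric_right_inverse mult_1_right)
qed

text \<open>Factors of index above \<open>d\<close> are 1 modulo \<open>X^(d+1)\<close>, so both
  sides reduce to \<open>qpoch_inv d\<close>.\<close>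

lemma fps_agree_qpoch_inv:
  assumes "d \<le> m" "d \<le> m'"
  shows "fps_agree d (qpoch_inv m) (qpoch_inv m' :: 'a::comm_ring_1 fps)"
proof -
  have "fps_agree d (qpoch_inv m) (qpoch_inv d :: 'a fps)" if "d \<le> m" for m
    using that
  proof (induction m rule: dec_induct)
    case (step m)
    have "fps_agree d (qpoch_inv (Suc m)) (qpoch_inv (Suc m) * 1 + fps_X ^ Suc m * (- qpoch_inv (Suc m)) :: 'a fps)"
      using fps_agree_add[OF fps_agree_refl fps_agree_sym[OF fps_agree_X_power_mult[of d "Suc m" "- qpoch_inv (Suc m) :: 'a fps"]], of "qpoch_inv (Suc m)"] step.hyps
      by simp
    also have "qpoch_inv (Suc m) * 1 + fps_X ^ Suc m * (- qpoch_inv (Suc m)) = (qpoch_inv m :: 'a fps)"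
      by (subst (3) qpoch_inv_Suc) (simp add: algebra_simps)
    finally show ?case using step.IH fps_agree_trans by blast
  qed simp
  then show ?thesis using assms fps_agree_sym fps_agree_trans by blast
qed

text \<open>Follows from the congruence of the inverses, multiplied by \<open>qpoch m\<close> and
  \<open>qpoch m'\<close>.\<close>

lemma fps_agree_qpoch:
  assumes "d \<le> m" "d \<le> m'"
  shows "fps_agree d (qpoch m) (qpoch m' :: 'a::comm_ring_1 fps)"
proof -
  have "fps_agree d (qpoch m * (qpoch_inv m' * qpoch m')) (qpoch m * (qpoch_inv m * qpoch m') :: 'a fps)"
    by (intro fps_agree_mult fps_agree_refl fps_agree_qpoch_inv assms)
  moreover have "qpoch m * (qpoch_inv m * qpoch m') = (qpoch m' :: 'a fps)"
    by (simp add: mult.assoc[symmetric] qpoch_mult_inv)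
  moreover have "qpoch_inv m' * qpoch m' = (1 :: 'a fps)"
    by (simp add: mult.commute qpoch_mult_inv)
  ultimately show ?thesis by simp
qed

section \<open>The Durfee rectangle identity\<close>

text \<open>Summand \<open>m\<close> is the generating function of the partitions whose Durfee
  rectangle has sides \<open>m\<close> and \<open>m + g\<close>; truncation at \<open>N\<close>
  keeps the sum finite.\<close>

definition durfee :: "nat \<Rightarrow> nat \<Rightarrow> 'a::comm_ring_1 fps" where
  "durfee N g = (\<Sum>m\<le>N. fps_X ^ (m * (m + g)) * (qpoch_inv m * qpoch_inv (m + g)))"

text \<open>
  Iterating this recurrence makes \<open>durfee N g - durfee N (g + 1)\<close> divisible by arbitrarily high
  powers of \<open>X\<close>, up to the truncation error of \<open>durfee N\<close>; as \<open>g\<close> grows, only the term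
  \<open>m = 0\<close> survives.
\<close>

lemma durfee_diff:
  "durfee (Suc N) g - durfee (Suc N) (Suc g) =
     fps_X ^ Suc g * (durfee N (Suc (Suc g)) - durfee (Suc N) (Suc g) :: 'a::comm_ring_1 fps)"
proof -
  let ?P = "qpoch_inv :: nat \<Rightarrow> 'a fps"
  define A where "A m = fps_X ^ (m * (m + g)) * (?P m * ?P (m + Suc g))" for m
  \<comment> \<open>Raising the index of the second inverse makes \<open>A m\<close> a common
    factor; its coefficient is \<open>1 - X^m - X^(m+g+1)\<close>.\<close>
  have split: "fps_X ^ (m * (m + g)) * (?P m * ?P (m + g)) - fps_X ^ (m * (m + Suc g)) * (?P m * ?P (m + Suc g))
     = (1 - fps_X ^ m) * A m - fps_X ^ Suc g * (fps_X ^ (m * (m + Suc g)) * (?P m * ?P (m + Suc g)))" for m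
    unfolding A_def by (subst qpoch_inv_Suc[of "m + g"]) (simp add: algebra_simps power_add)
  \<comment> \<open>The factor \<open>1 - X^(m+1)\<close> lowers the index of one inverse, and
    (m+1)(m+1+g) = (g+1) + m(m+g+2).\<close>
  have shift: "(1 - fps_X ^ Suc m) * A (Suc m) =
     fps_X ^ Suc g * (fps_X ^ (m * (m + Suc (Suc g))) * (?P m * ?P (m + Suc (Suc g))))" for m
    unfolding A_def by (subst qpoch_inv_Suc[of m]) (simp add: algebra_simps power_add)
  have "durfee (Suc N) g - durfee (Suc N) (Suc g) =
     (\<Sum>m\<le>Suc N. (1 - fps_X ^ m) * A m) - fps_X ^ Suc g * durfee (Suc N) (Suc g)"
    unfolding durfee_def sum_subtractf[symmetric] sum_distrib_left split ..
  also have "(\<Sum>m\<le>Suc N. (1 - fps_X ^ m) * A m) = (\<Sum>m\<le>N. (1 - fps_X ^ Suc m) * A (Suc m))"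
    by (subst sum.atMost_Suc_shift) simp
  also have "\<dots> = fps_X ^ Suc g * durfee N (Suc (Suc g))"
    unfolding durfee_def sum_distrib_left shift ..
  finally show ?thesis by (simp add: algebra_simps)
qed

text \<open>In \<open>durfee_diff\<close> the bracket vanishes modulo \<open>X^(d+1)\<close> by the
  induction hypothesis, and the factor \<open>X^(g+1)\<close> gains at least one more
  degree.\<close>

lemma fps_agree_durfee_Suc:
  "d \<le> N \<Longrightarrow> fps_agree d (durfee N g) (durfee N (Suc g) :: 'a::comm_ring_1 fps)"
proof (induction d arbitrary: N g)
  case 0
  show ?case
  proof (cases N)
    case (Suc N')
    have "fps_nth (durfee N g - durfee N (Suc g) :: 'a fps) 0 = 0"
      unfolding Suc durfee_diff by simp
    then show ?thesis by (simp add: fps_agree_def)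
  next
    case 0
    have "fps_agree 0 (qpoch_inv m) (qpoch_inv m' :: 'a fps)" for m m'
      by (rule fps_agree_qpoch_inv) simp_all
    with 0 show ?thesis by (simp add: durfee_def qpoch_inv_def[of 0])
  qed
next
  case (Suc d)
  then obtain N' where N: "N = Suc N'" "d \<le> N'" by (cases N) auto
  \<comment> \<open>Passing from truncation \<open>N'\<close> to \<open>N\<close> adds only the
    summand \<open>m = N\<close>, whose exponent exceeds \<open>d\<close>.\<close>
  have "fps_agree d (durfee N' (Suc (Suc g)) + 0) (durfee N' (Suc (Suc g)) + fps_X ^ (N * (N + Suc (Suc g))) * (qpoch_inv N * qpoch_inv (N + Suc (Suc g))) :: 'a fps)"
    by (intro fps_agree_add fps_agree_refl fps_agree_sym[OF fps_agree_X_power_mult]) (use N in auto)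
  also have "\<dots> = durfee N (Suc (Suc g))" by (simp add: durfee_def N(1))
  also have "fps_agree d \<dots> (durfee N (Suc g))"
    using Suc.IH[of N "Suc g"] Suc.prems fps_agree_sym by fastforce
  finally have "fps_agree d (durfee N' (Suc (Suc g))) (durfee N (Suc g) :: 'a fps)" by simp
  then have "fps_nth (durfee N g - durfee N (Suc g) :: 'a fps) i = 0" if "i \<le> Suc d" for i
    using that unfolding N(1) durfee_diff by (auto simp: fps_X_power_mult_nth fps_agree_def simp del: power_Suc)
  then show ?case by (simp add: fps_agree_def)
qed

lemma fps_agree_durfee:
  assumes "d \<le> N" "d \<le> M"
  shows "fps_agree d (durfee N g) (qpoch_inv M :: 'a::comm_ring_1 fps)"
proof -
  have "fps_agree d (durfee N g) (durfee N (g + j) :: 'a fps)" for j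
  proof (induction j)
    case (Suc j)
    with fps_agree_durfee_Suc[OF assms(1), of "g + j"] show ?case
      using fps_agree_trans by fastforce
  qed simp
  \<comment> \<open>After the shift by \<open>d\<close>, every summand with \<open>m > 0\<close> has
    exponent at least \<open>g + d + 1\<close>.\<close>
  also have "fps_agree d (durfee N (g + d))
     (\<Sum>m\<in>{0}. fps_X ^ (m * (m + (g + d))) * (qpoch_inv m * qpoch_inv (m + (g + d))) :: 'a fps)"
    unfolding durfee_def
  proof (intro fps_agree_sum_neutral fps_agree_X_power_mult)
    fix m assume "m \<in> {..N} - {0}"
    then show "d < m * (m + (g + d))" by (cases m) auto
  qed auto
  also have "\<dots> = qpoch_inv (g + d)" by (simp add: qpoch_inv_def)
  also have "fps_agree d (qpoch_inv (g + d)) (qpoch_inv M :: 'a fps)"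
    by (intro fps_agree_qpoch_inv assms) simp
  finally show ?thesis .
qed

text \<open>The form needed for a root lattice coordinate of either sign. If
  \<open>g = - int k\<close>, replacing \<open>m\<close> by \<open>m + k\<close> swaps the sides of
  the rectangle and shortens the truncation to \<open>N - k\<close>, hence the margin in the
  assumption.\<close>

lemma fps_agree_durfee_rectangle:
  fixes g :: int
  assumes "d + nat \<bar>g\<bar> \<le> N" "d \<le> M"
  shows "fps_agree d (\<Sum>m | m \<le> N \<and> 0 \<le> int m + g.
      fps_X ^ (m * nat (int m + g)) * (qpoch_inv m * qpoch_inv (nat (int m + g))))
      (qpoch_inv M :: 'a::comm_ring_1 fps)"
proof (cases "g \<ge> 0")
  case True
  then obtain k where "g = int k" using nonneg_int_cases by blast
  then have "{m. m \<le> N \<and> 0 \<le> int m + g} = {..N}" "nat (int m + g) = m + k" for m by auto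
  then show ?thesis
    using fps_agree_durfee[of d N M k] assms by (simp add: durfee_def)
next
  case False
  then obtain k where k: "g = - int k" by (metis int_cases2 linorder_le_cases of_nat_0_le_iff)
  have "(\<Sum>m | m \<le> N \<and> 0 \<le> int m + g.
      fps_X ^ (m * nat (int m + g)) * (qpoch_inv m * qpoch_inv (nat (int m + g)))) = (durfee (N - k) k :: 'a fps)"
    unfolding durfee_def
  proof (rule sum.reindex_bij_witness[of _ "\<lambda>m. m + k" "\<lambda>m. m - k"])
    fix m assume "m \<in> {m. m \<le> N \<and> 0 \<le> int m + g}"
    then have "nat (int m + g) = m - k" "m = (m - k) + k" using k by auto
    then show "fps_X ^ ((m - k) * (m - k + k)) * (qpoch_inv (m - k) * qpoch_inv (m - k + k)) =
        fps_X ^ (m * nat (int m + g)) * (qpoch_inv m * qpoch_inv (nat (int m + g)) :: 'a fps)"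
      by (metis mult.commute)
  qed (use assms k in auto)
  moreover have "d \<le> N - k" using assms k by auto
  ultimately show ?thesis
    using fps_agree_durfee[of d "N - k" M k] assms by simp
qed

section \<open>MacMahon's theorem for words\<close>

primrec word_desc :: "nat list \<Rightarrow> nat" where
  "word_desc [] = 0"
| "word_desc (c # w) = length (filter (\<lambda>x. x < c) w) + word_desc w"

definition words_with_content :: "nat set \<Rightarrow> (nat \<Rightarrow> nat) \<Rightarrow> nat list set" where
  "words_with_content A f = {w. set w \<subseteq> A \<and> (\<forall>i\<in>A. count_list w i = f i)}"

lemma length_words_with_content:
  "finite A \<Longrightarrow> w \<in> words_with_content A f \<Longrightarrow> length w = sum f A"
  using sum_count_set[of w A] by (simp add: words_with_content_def)

lemma finite_words_with_content: "finite A \<Longrightarrow> finite (words_with_content A f)"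
  by (rule finite_subset[OF _ finite_lists_length_eq[of A "sum f A"]])
     (use length_words_with_content in \<open>auto simp: words_with_content_def\<close>)

lemma length_filter_eq_sum_count:
  "finite A \<Longrightarrow> set w \<subseteq> A \<Longrightarrow> length (filter P w) = (\<Sum>i | i \<in> A \<and> P i. count_list w i)"
proof (induction w)
  case (Cons c w)
  have "(\<Sum>i | i \<in> A \<and> P i. count_list (c # w) i) = (\<Sum>i | i \<in> A \<and> P i. (if c = i then 1 else 0) + count_list w i)"
    by (intro sum.cong) auto
  also have "\<dots> = (if P c then 1 else 0) + (\<Sum>i | i \<in> A \<and> P i. count_list w i)"
    using Cons.prems by (subst sum.distrib) (auto simp: sum.delta)
  finally show ?case using Cons by auto
qed simp

text \<open>With the letters in increasing order the exponents are partial sums of \<open>f\<close>,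
  and each summand is a difference of two consecutive powers.\<close>

lemma telescoping_content:
  fixes A :: "nat set" and q :: "'a::comm_ring_1"
  assumes "finite A"
  shows "(\<Sum>c\<in>A. q ^ (\<Sum>i | i \<in> A \<and> i < c. f i) * (1 - q ^ f c)) = 1 - q ^ sum f A"
  using assms
proof (induction A rule: finite_linorder_max_induct)
  case (insert b A)
  have 1: "{i. i \<in> insert b A \<and> i < b} = A" using insert by auto
  have 2: "{i. i \<in> insert b A \<and> i < c} = {i. i \<in> A \<and> i < c}" if "c \<in> A" for c
    using insert that by auto
  have "b \<notin> A" using insert by auto
  then show ?case
    using insert by (simp add: 1 2 algebra_simps power_add del: insert_iff cong: sum.cong)
qed simp

text \<open>The q-multinomial formula with denominators cleared. A first letter \<open>c\<close>
  accounts for one decreasing pair with each smaller letter; summing over \<open>c\<close>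
  telescopes to the new factor \<open>1 - X^(K+1)\<close>.\<close>

lemma macmahon_word_desc:
  assumes "finite A"
  shows "(\<Sum>w\<in>words_with_content A f. fps_X ^ word_desc w) * (\<Prod>i\<in>A. qpoch (f i)) =
    (qpoch (sum f A) :: 'a::comm_ring_1 fps)"
proof (induction "sum f A" arbitrary: f)
  case 0
  then have "words_with_content A f = {[]}" "\<forall>i\<in>A. f i = 0"
    using assms length_words_with_content[OF assms, of _ f] by (auto simp: words_with_content_def)
  then show ?case by simp
next
  case (Suc K)
  \<comment> \<open>The letters that can stand first; for them \<open>f c - 1\<close> is a true
    predecessor.\<close>
  define A' where "A' = {c\<in>A. f c > 0}"
  define f' where "f' c = f(c := f c - 1)" for c
  have sum_f': "sum (f' c) A = K" if "c \<in> A'" for c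
  proof -
    have "sum (f' c) A + 1 = (\<Sum>i\<in>A. f' c i + (if c = i then 1 else 0))"
      using that assms by (subst sum.distrib) (simp add: A'_def)
    also have "\<dots> = sum f A" using that by (intro sum.cong) (auto simp: f'_def A'_def)
    finally show ?thesis using Suc by simp
  qed
  have prod_f': "(\<Prod>i\<in>A. qpoch (f i)) = (\<Prod>i\<in>A. qpoch (f' c i)) * (1 - fps_X ^ f c :: 'a fps)" if "c \<in> A'" for c
  proof -
    have c: "c \<in> A" "f c = Suc (f c - 1)" using that by (auto simp: A'_def)
    have "(\<Prod>i\<in>A. qpoch (f i)) = qpoch (f c) * (\<Prod>i\<in>A-{c}. qpoch (f i) :: 'a fps)"
      using c assms by (simp add: prod.remove)
    also have "qpoch (f c) = qpoch (f c - 1) * (1 - fps_X ^ f c :: 'a fps)"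
      using qpoch_Suc[of "f c - 1"] c(2) by (metis (no_types))
    also have "(\<Prod>i\<in>A-{c}. qpoch (f i) :: 'a fps) = (\<Prod>i\<in>A-{c}. qpoch (f' c i))"
      by (intro prod.cong) (auto simp: f'_def)
    also have "qpoch (f c - 1) * (1 - fps_X ^ f c) * \<dots> = (\<Prod>i\<in>A. qpoch (f' c i)) * (1 - fps_X ^ f c :: 'a fps)"
      using c assms by (simp add: prod.remove f'_def mult_ac)
    finally show ?thesis .
  qed
  define s where "s c = (\<Sum>i | i \<in> A \<and> i < c. f i)" for c
  have "(\<Sum>w\<in>words_with_content A f. fps_X ^ word_desc w) =
     (\<Sum>(c,w)\<in>(SIGMA c:A'. words_with_content A (f' c)). fps_X ^ s c * fps_X ^ word_desc w :: 'a fps)"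
  proof (rule sum.reindex_bij_witness[of _ "\<lambda>(c,w). c # w" "\<lambda>w. (hd w, tl w)"], goal_cases)
    case (1 w)
    then have "length w \<noteq> 0" using length_words_with_content[OF assms 1] Suc.hyps by simp
    then show ?case by simp
  next
    case (2 w)
    then have "length w \<noteq> 0" using length_words_with_content[OF assms 2] Suc.hyps by simp
    with 2 show ?case by (cases w) (auto simp: words_with_content_def A'_def f'_def)
  next
    case (4 p)
    then show ?case by (auto simp: words_with_content_def A'_def f'_def split: if_splits)
  next
    case (5 w)
    then have "length w \<noteq> 0" using length_words_with_content[OF assms 5] Suc.hyps by simp
    then obtain c v where w: "w = c # v" by (cases w) auto
    have "length (filter (\<lambda>x. x < c) v) = (\<Sum>i | i \<in> A \<and> i < c. count_list v i)"
      using 5 w assms by (intro length_filter_eq_sum_count) (auto simp: words_with_content_def)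
    also have "\<dots> = s c" unfolding s_def
      using 5 w by (intro sum.cong) (auto simp: words_with_content_def)
    finally show ?case using w by (simp add: power_add)
  qed auto
  also have "\<dots> = (\<Sum>c\<in>A'. fps_X ^ s c * (\<Sum>w\<in>words_with_content A (f' c). fps_X ^ word_desc w))"
    using assms by (subst sum.Sigma[symmetric]) (auto simp: A'_def finite_words_with_content sum_distrib_left)
  also have "\<dots> * (\<Prod>i\<in>A. qpoch (f i)) = (\<Sum>c\<in>A'. fps_X ^ s c * (1 - fps_X ^ f c) * qpoch K)"
    unfolding sum_distrib_right
  proof (rule sum.cong)
    fix c assume c: "c \<in> A'"
    show "fps_X ^ s c * (\<Sum>w\<in>words_with_content A (f' c). fps_X ^ word_desc w) * (\<Prod>i\<in>A. qpoch (f i)) =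
        fps_X ^ s c * (1 - fps_X ^ f c) * (qpoch K :: 'a fps)"
      using Suc.hyps(1)[of "f' c"] sum_f'[OF c] unfolding prod_f'[OF c] by (simp add: mult_ac)
  qed simp
  \<comment> \<open>Letters outside \<open>A'\<close> have \<open>f c = 0\<close>, so their factor
    \<open>1 - X^0\<close> vanishes.\<close>
  also have "\<dots> = (\<Sum>c\<in>A. fps_X ^ s c * (1 - fps_X ^ f c)) * qpoch K"
    unfolding sum_distrib_right using assms by (intro sum.mono_neutral_left) (auto simp: A'_def)
  also have "\<dots> = (1 - fps_X ^ Suc K) * qpoch K"
    unfolding s_def telescoping_content[OF assms] Suc.hyps(2)[symmetric] ..
  also have "\<dots> = qpoch (sum f A)"
    unfolding Suc.hyps(2)[symmetric] qpoch_Suc by (rule mult.commute)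
  finally show ?case .
qed

section \<open>Fillings as pairs of words\<close>

primrec word_asc :: "nat list \<Rightarrow> nat" where
  "word_asc [] = 0"
| "word_asc (c # w) = length (filter (\<lambda>x. c < x) w) + word_asc w"

text \<open>The recursion suits induction on words; the count over positions is what the inversions
  of a filling produce.\<close>

lemma word_asc_eq_card:
  "word_asc w = card {(j, j'). j < j' \<and> j' < length w \<and> w ! j < w ! j'}"
proof (induction w)
  case (Cons c w)
  let ?A = "(\<lambda>j'. (0::nat, Suc j')) ` {j'. j' < length w \<and> c < w ! j'}"
  let ?S = "{(j, j'). j < j' \<and> j' < length w \<and> w ! j < w ! j'}"
  have fin: "finite ?S"
    by (rule finite_subset[of _ "{..<length w} \<times> {..<length w}"]) auto
  have "{(j, j'). j < j' \<and> j' < length (c # w) \<and> (c # w) ! j < (c # w) ! j'} = ?A \<union> map_prod Suc Suc ` ?S"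
  proof (intro set_eqI iffI)
    fix p assume "p \<in> {(j, j'). j < j' \<and> j' < length (c # w) \<and> (c # w) ! j < (c # w) ! j'}"
    then obtain j j' where p: "p = (j, Suc j')" "j < Suc j'" "j' < length w" "(c # w) ! j < w ! j'"
      by (cases p) (auto elim: lessE)
    then show "p \<in> ?A \<union> map_prod Suc Suc ` ?S"
      by (cases j) (auto simp: image_iff)
  qed auto
  moreover have "card (?A \<union> map_prod Suc Suc ` ?S) = card ?A + card (map_prod Suc Suc ` ?S)"
    using fin by (intro card_Un_disjoint) auto
  moreover have "card ?A = length (filter (\<lambda>x. c < x) w)"
    by (subst card_image) (auto simp: inj_on_def length_filter_conv_card)
  moreover have "card (map_prod Suc Suc ` ?S) = card ?S"
    by (intro card_image) (auto simp: inj_on_def)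
  ultimately show ?case using Cons.IH by simp
qed simp

lemma count_list_eq_card: "count_list w x = card {j. j < length w \<and> w ! j = x}"
  by (simp add: count_list_eq_length_filter length_filter_conv_card eq_commute)

definition words :: "nat \<Rightarrow> nat \<Rightarrow> nat list set" where
  "words n k = {w. set w \<subseteq> {1..n} \<and> length w = k}"

lemma finite_words: "finite (words n k)"
  unfolding words_def by (rule finite_lists_length_eq) simp

lemma words_nth: "w \<in> words n k \<Longrightarrow> j < k \<Longrightarrow> 1 \<le> w ! j \<and> w ! j \<le> n"
  using nth_mem[of j w] by (auto simp: words_def simp del: nth_mem)

section \<open>Columns of height n - 1 as complements of a letter\<close>

text \<open>The entry in row \<open>i\<close>, counted from 0, of the increasing column that
  contains every letter of [n] except \<open>a\<close>.\<close>

definition omit_entry :: "nat \<Rightarrow> nat \<Rightarrow> nat" where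
  "omit_entry a i = (if i + 1 < a then i + 1 else i + 2)"

text \<open>The word \<open>b\<close> runs from the last column leftwards: its head is the entry of
  the last column, and inversions between short columns become ascents of \<open>b\<close>. The
  restriction yields the extensional functions of \<open>column_strict_fillings\<close>.\<close>

definition filling_of :: "nat \<Rightarrow> nat \<Rightarrow> nat list \<Rightarrow> nat list \<Rightarrow> nat \<times> nat \<Rightarrow> nat" where
  "filling_of n k a b = restrict (\<lambda>(i, j). if j < k then omit_entry (a ! j) i else b ! (2 * k - 1 - j))
     (dg (k_theta n k))"

lemma dg_k_theta:
  assumes "n \<ge> 2"
  shows "dg (k_theta n k) = {(i, j). i < n - 1 \<and> j < k \<or> i = 0 \<and> j < 2 * k}"
proof -
  have "k_theta n k ! i = (if i = 0 then 2 * k else if i < n - 1 then k else 0)" if "i < n" for i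
    using that assms by (auto simp: k_theta_def theta_def nth_Cons' nth_append)
  moreover have "length (k_theta n k) = n" using assms by (simp add: k_theta_def theta_def)
  ultimately show ?thesis using assms by (auto simp: dg_def split: if_splits)
qed

lemma filling_of_left:
  "n \<ge> 2 \<Longrightarrow> i < n - 1 \<Longrightarrow> j < k \<Longrightarrow> filling_of n k a b (i, j) = omit_entry (a ! j) i"
  by (simp add: filling_of_def dg_k_theta)

lemma filling_of_right:
  "n \<ge> 2 \<Longrightarrow> k \<le> j \<Longrightarrow> j < 2 * k \<Longrightarrow> filling_of n k a b (0, j) = b ! (2 * k - 1 - j)"
  by (simp add: filling_of_def dg_k_theta)

lemma omit_entry_mono: "i < i' \<Longrightarrow> omit_entry a i < omit_entry a i'"
  by (auto simp: omit_entry_def)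

lemma omit_entry_inj:
  assumes "\<And>i. i < n - 1 \<Longrightarrow> omit_entry a i = omit_entry a' i"
    and "1 \<le> a" "a \<le> n" "1 \<le> a'" "a' \<le> n"
  shows "a = a'"
proof (rule ccontr)
  assume "a \<noteq> a'"
  then consider "a < a'" | "a' < a" by linarith
  then show False
  proof cases
    case 1
    \<comment> \<open>In row \<open>a - 1\<close> the column without \<open>a\<close> already holds
      \<open>a + 1\<close>, while the column without \<open>a'\<close> still holds
      \<open>a\<close>.\<close>
    then have "a - 1 < n - 1" using assms(2-) by simp
    with assms(1)[OF this] assms(2-) \<open>a < a'\<close> show False by (simp add: omit_entry_def)
  next
    case 2
    then have "a' - 1 < n - 1" using assms(2-) by simp
    with assms(1)[OF this] assms(2-) \<open>a' < a\<close> show False by (simp add: omit_entry_def)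
  qed
qed

text \<open>Strict increase within [n] leaves row \<open>i\<close> only the values
  \<open>i + 1\<close> and \<open>i + 2\<close>, and once the larger one occurs it persists. The
  first such row determines the missing letter; without such a row it is \<open>n\<close>.\<close>

lemma ex_omit_entry:
  assumes n: "n \<ge> 2" and mono: "\<And>i i'. i < i' \<Longrightarrow> i' < n - 1 \<Longrightarrow> c i < c i'"
    and range: "\<And>i. i < n - 1 \<Longrightarrow> 1 \<le> c i \<and> c i \<le> n"
  shows "\<exists>a. 1 \<le> a \<and> a \<le> n \<and> (\<forall>i<n - 1. c i = omit_entry a i)"
proof -
  have lower: "i < n - 1 \<Longrightarrow> i + 1 \<le> c i" for i
  proof (induction i)
    case 0 then show ?case using range[of 0] by simp
  next
    case (Suc i) then show ?case using mono[of i "Suc i"] by simp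
  qed
  have gap: "i + m < n - 1 \<Longrightarrow> c i + m \<le> c (i + m)" for i m
  proof (induction m)
    case (Suc m) then show ?case using mono[of "i + m" "i + Suc m"] by simp
  qed simp
  have upper: "c i \<le> i + 2" if "i < n - 1" for i
  proof -
    have eq: "i + (n - 2 - i) = n - 2" using that by simp
    then have "c i + (n - 2 - i) \<le> c (n - 2)" using gap[of i "n - 2 - i"] n by simp
    also have "\<dots> \<le> n" using range[of "n - 2"] n by simp
    finally show ?thesis using eq n by simp
  qed
  show ?thesis
  proof (cases "\<exists>i<n - 1. c i = i + 2")
    case True
    define i0 where "i0 = (LEAST i. i < n - 1 \<and> c i = i + 2)"
    have i0: "i0 < n - 1" "c i0 = i0 + 2"
      using LeastI_ex[OF True] by (simp_all add: i0_def)
    have least: "i0 \<le> i" if "i < n - 1" "c i = i + 2" for i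
      unfolding i0_def using that by (intro Least_le) simp
    have "c i = omit_entry (Suc i0) i" if i: "i < n - 1" for i
    proof (cases "i < i0")
      case True
      then have "c i \<noteq> i + 2" using least[OF i] by auto
      then show ?thesis using True lower[OF i] upper[OF i] by (simp add: omit_entry_def)
    next
      case False
      then show ?thesis using gap[of i0 "i - i0"] i0 i upper[OF i] by (simp add: omit_entry_def)
    qed
    then show ?thesis using i0 by (intro exI[of _ "Suc i0"]) auto
  next
    case False
    have "c i = omit_entry n i" if i: "i < n - 1" for i
      using False lower[OF i] upper[OF i] i by (force simp: omit_entry_def)
    then show ?thesis using n by (intro exI[of _ n]) auto
  qed
qed

text \<open>Rows carry no condition, so the columns are independent: each long one amounts to its
  missing letter, each short one to its single entry.\<close>

lemma bij_betw_filling_of: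
  assumes n: "n \<ge> 2"
  shows "bij_betw (\<lambda>(a, b). filling_of n k a b) (words n k \<times> words n k)
    (column_strict_fillings (k_theta n k) n)"
  unfolding bij_betw_def
proof
  show "inj_on (\<lambda>(a, b). filling_of n k a b) (words n k \<times> words n k)"
  proof (rule inj_onI, clarsimp)
    fix a b a' b' assume w: "a \<in> words n k" "b \<in> words n k" "a' \<in> words n k" "b' \<in> words n k"
      and eq: "filling_of n k a b = filling_of n k a' b'"
    have "a ! j = a' ! j" if j: "j < k" for j
    proof (rule omit_entry_inj)
      show "omit_entry (a ! j) i = omit_entry (a' ! j) i" if "i < n - 1" for i
        using fun_cong[OF eq, of "(i, j)"] j that n by (simp add: filling_of_left)
    qed (use words_nth w j in auto)
    moreover have "b ! j = b' ! j" if j: "j < k" for j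
      using fun_cong[OF eq, of "(0, 2 * k - 1 - j)"] j n by (simp add: filling_of_right)
    ultimately show "a = a' \<and> b = b'"
      using w by (auto simp: words_def intro: nth_equalityI)
  qed
  show "(\<lambda>(a, b). filling_of n k a b) ` (words n k \<times> words n k) = column_strict_fillings (k_theta n k) n"
  proof (intro subset_antisym subsetI)
    fix F assume "F \<in> (\<lambda>(a, b). filling_of n k a b) ` (words n k \<times> words n k)"
    then obtain a b where w: "a \<in> words n k" "b \<in> words n k" and F: "F = filling_of n k a b"
      by auto
    have "F (i, j) \<in> {1..n}" if "(i, j) \<in> dg (k_theta n k)" for i j
    proof (cases "j < k")
      case True
      with that n show ?thesis
        by (auto simp: F dg_k_theta filling_of_left omit_entry_def)
    next
      case False
      with that n have "i = 0" "j < 2 * k" by (auto simp: dg_k_theta)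
      then show ?thesis
        using words_nth[OF w(2), of "2 * k - 1 - j"] False n by (simp add: F filling_of_right)
    qed
    moreover have "F (i, j) < F (i', j)"
      if "(i, j) \<in> dg (k_theta n k)" "(i', j) \<in> dg (k_theta n k)" "i < i'" for i i' j
      using that n by (auto simp: F dg_k_theta filling_of_left omit_entry_mono)
    moreover have "F \<in> extensional (dg (k_theta n k))"
      by (simp add: F filling_of_def)
    ultimately show "F \<in> column_strict_fillings (k_theta n k) n"
      by (auto simp: column_strict_fillings_def PiE_iff)
  next
    fix F assume F: "F \<in> column_strict_fillings (k_theta n k) n"
    have rng: "1 \<le> F (i, j) \<and> F (i, j) \<le> n" if "(i, j) \<in> dg (k_theta n k)" for i j
      using F that by (auto simp: column_strict_fillings_def PiE_iff)
    have "\<exists>a. 1 \<le> a \<and> a \<le> n \<and> (\<forall>i<n - 1. F (i, j) = omit_entry a i)" if "j < k" for j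
      by (rule ex_omit_entry) (use F that n rng in \<open>auto simp: column_strict_fillings_def dg_k_theta\<close>)
    then obtain a where a: "\<And>j. j < k \<Longrightarrow> 1 \<le> a j \<and> a j \<le> n \<and> (\<forall>i<n - 1. F (i, j) = omit_entry (a j) i)"
      by metis
    define a' where "a' = map a [0..<k]"
    define b' where "b' = map (\<lambda>j. F (0, 2 * k - 1 - j)) [0..<k]"
    have "a' \<in> words n k" using a by (auto simp: words_def a'_def)
    moreover have "b' \<in> words n k" using rng n by (auto simp: words_def b'_def dg_k_theta)
    moreover have "F = filling_of n k a' b'"
    proof
      fix c :: "nat \<times> nat"
      obtain i j where c: "c = (i, j)" by force
      consider "(i, j) \<notin> dg (k_theta n k)" | "i < n - 1" "j < k" | "i = 0" "k \<le> j" "j < 2 * k"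
        using n by (auto simp: dg_k_theta) linarith
      then show "F c = filling_of n k a' b' c"
      proof cases
        case 1
        moreover have "F \<in> extensional (dg (k_theta n k))"
          using F by (auto simp: column_strict_fillings_def PiE_iff)
        ultimately show ?thesis
          unfolding c by (simp add: filling_of_def extensional_def)
      next
        case 2
        then show ?thesis using n a c by (simp add: filling_of_left a'_def)
      next
        case 3
        then have "2 * k - Suc (2 * k - Suc j) = j" "2 * k - Suc j < k" by auto
        with 3 show ?thesis using n c by (simp add: filling_of_right b'_def)
      qed
    qed
    ultimately show "F \<in> (\<lambda>(a, b). filling_of n k a b) ` (words n k \<times> words n k)" by auto
  qed
qed

text \<open>For \<open>k > 0\<close> the first column lacks 1 exactly if \<open>a\<close> starts
  with 1, and the last column is one cell containing the head of \<open>b\<close>. The guard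
  \<open>k > 0\<close> avoids \<open>hd []\<close> and admits the empty filling.\<close>

lemma filling_of_in_C_fillings_iff:
  assumes n: "n \<ge> 2" and w: "a \<in> words n k" "b \<in> words n k"
  shows "filling_of n k a b \<in> C_fillings n k \<longleftrightarrow> \<not> (k > 0 \<and> hd a = 1 \<and> hd b = 1)"
proof -
  have "filling_of n k a b \<in> column_strict_fillings (k_theta n k) n"
    using bij_betw_apply[OF bij_betw_filling_of[OF n], of "(a, b)" k] w by simp
  moreover have "(\<exists>i. (i, 0) \<in> dg (k_theta n k) \<and> filling_of n k a b (i, 0) = 1) \<longleftrightarrow> k > 0 \<and> hd a \<noteq> 1"
  proof (cases "k > 0")
    case True
    then have "a \<noteq> []" "hd a \<ge> 1" using w words_nth[OF w(1), of 0] by (auto simp: words_def hd_conv_nth)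
    then show ?thesis
      using True n by (auto simp: dg_k_theta filling_of_left omit_entry_def hd_conv_nth intro!: exI[of _ 0])
  qed (use n in \<open>auto simp: dg_k_theta\<close>)
  moreover have "(\<exists>i j. j + 1 = hd (k_theta n k) \<and> (i, j) \<in> dg (k_theta n k) \<and> filling_of n k a b (i, j) = 1)
     \<longleftrightarrow> k > 0 \<and> hd b = 1"
  proof (cases "k > 0")
    case True
    have hd: "hd (k_theta n k) = 2 * k" by (simp add: k_theta_def theta_def)
    have "b \<noteq> []" using True w by (auto simp: words_def)
    have "(\<exists>i j. j + 1 = hd (k_theta n k) \<and> (i, j) \<in> dg (k_theta n k) \<and> filling_of n k a b (i, j) = 1)
      \<longleftrightarrow> filling_of n k a b (0, 2 * k - 1) = 1"
    proof
      assume "\<exists>i j. j + 1 = hd (k_theta n k) \<and> (i, j) \<in> dg (k_theta n k) \<and> filling_of n k a b (i, j) = 1"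
      then obtain i j where ij: "j + 1 = 2 * k" "(i, j) \<in> dg (k_theta n k)" "filling_of n k a b (i, j) = 1"
        unfolding hd by blast
      then have "j = 2 * k - 1" "i = 0" using n True by (auto simp: dg_k_theta)
      with ij show "filling_of n k a b (0, 2 * k - 1) = 1" by simp
    next
      assume "filling_of n k a b (0, 2 * k - 1) = 1"
      then show "\<exists>i j. j + 1 = hd (k_theta n k) \<and> (i, j) \<in> dg (k_theta n k) \<and> filling_of n k a b (i, j) = 1"
        unfolding hd using True n by (intro exI[of _ 0] exI[of _ "2 * k - 1"]) (auto simp: dg_k_theta)
    qed
    then show ?thesis using True n \<open>b \<noteq> []\<close> by (simp add: filling_of_right hd_conv_nth)
  qed (use n in \<open>auto simp: dg_k_theta\<close>)
  ultimately show ?thesis unfolding C_fillings_def by blast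
qed

section \<open>Inversions of a filling\<close>

text \<open>The column without \<open>a\<close> stands to the left. Inversions within a row occur in
  rows \<open>a - 1\<close> to \<open>a' - 2\<close>; the \<open>n - 2\<close> diagonal pairs are
  all inversions except those with \<open>i\<close> from \<open>a - 1\<close> to
  \<open>a' - 3\<close>. For \<open>a < a'\<close> the gain exceeds the loss by one, otherwise both
  ranges are empty.\<close>

lemma card_column_pair_inversions:
  assumes "n \<ge> 2" "1 \<le> a" "a \<le> n" "1 \<le> a'" "a' \<le> n"
  shows "card {i. i < n - 1 \<and> omit_entry a' i < omit_entry a i} +
      card {i. Suc i < n - 1 \<and> omit_entry a i < omit_entry a' (Suc i)} =
      n - 2 + (if a < a' then 1 else 0)"
proof -
  have 1: "{i. i < n - 1 \<and> omit_entry a' i < omit_entry a i} = {a - 1..<a' - 1}"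
    using assms by (auto simp: omit_entry_def split: if_splits)
  have 2: "{i. Suc i < n - 1 \<and> omit_entry a i < omit_entry a' (Suc i)} = {..<n - 2} - {a - 1..<a' - 2}"
    using assms by (auto simp: omit_entry_def split: if_splits)
  have "{a - 1..<a' - 2} \<subseteq> {..<n - 2}" using assms by auto
  then have "card ({..<n - 2} - {a - 1..<a' - 2}) = n - 2 - (a' - 2 - (a - 1))"
    by (subst card_Diff_subset) auto
  then show ?thesis unfolding 1 2 using assms by auto
qed

text \<open>Inversions are grouped by their two columns, which differ because attacking cells never
  share a column. Within a row the left cell is read first; in adjacent rows the right cell is the
  lower one and is read first.\<close>

lemma card_Inv_eq_sum:
  assumes n: "n \<ge> 2"
  shows "card (Inv (k_theta n k) F) = (\<Sum>(j, j') | j < j' \<and> j' < 2 * k.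
    card {i. (i, j) \<in> dg (k_theta n k) \<and> (i, j') \<in> dg (k_theta n k) \<and> F (i, j') < F (i, j)} +
    card {i. (i, j) \<in> dg (k_theta n k) \<and> (Suc i, j') \<in> dg (k_theta n k) \<and> F (i, j) < F (Suc i, j')})"
proof -
  let ?d = "dg (k_theta n k)" and ?I = "Inv (k_theta n k) F"
  let ?P = "{(j, j'). j < j' \<and> j' < 2 * k}"
  let ?g = "\<lambda>(u :: nat \<times> nat, w :: nat \<times> nat). (min (snd u) (snd w), max (snd u) (snd w))"
  have d_sub: "?d \<subseteq> {..<n} \<times> {..<2 * k}" using n by (auto simp: dg_k_theta)
  then have fin_d: "finite ?d" by (rule finite_subset) simp
  have fin_I: "finite ?I"
    by (rule finite_subset[of _ "?d \<times> ?d"]) (use fin_d in \<open>auto simp: Inv_def\<close>)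
  have fin_P: "finite ?P"
    by (rule finite_subset[of _ "{..<2 * k} \<times> {..<2 * k}"]) auto
  have "card ?I = (\<Sum>p\<in>?P. card {x \<in> ?I. ?g x = p})"
  proof -
    have "?g ` ?I \<subseteq> ?P"
      using d_sub by (fastforce simp: Inv_def attack_def precedes_def)
    from sum.group[OF fin_I fin_P this, of "\<lambda>_. 1"] show ?thesis unfolding card_eq_sum by (rule sym)
  qed
  also have "\<dots> = (\<Sum>(j, j')\<in>?P. card {i. (i, j) \<in> ?d \<and> (i, j') \<in> ?d \<and> F (i, j') < F (i, j)} +
    card {i. (i, j) \<in> ?d \<and> (Suc i, j') \<in> ?d \<and> F (i, j) < F (Suc i, j')})"
  proof (rule sum.cong, simp, clarify)
    fix j j' assume jj': "j < j'" "j' < 2 * k"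
    let ?A = "{i. (i, j) \<in> ?d \<and> (i, j') \<in> ?d \<and> F (i, j') < F (i, j)}"
    let ?B = "{i. (i, j) \<in> ?d \<and> (Suc i, j') \<in> ?d \<and> F (i, j) < F (Suc i, j')}"
    have fin: "finite ?A" "finite ?B"
      using d_sub by (auto intro!: finite_subset[of _ "{..<n}"])
    have "{x \<in> ?I. ?g x = (j, j')} =
       (\<lambda>i. ((i, j), (i, j'))) ` ?A \<union> (\<lambda>i. ((Suc i, j'), (i, j))) ` ?B"
    proof (intro subset_antisym subsetI)
      fix x assume x: "x \<in> {x \<in> ?I. ?g x = (j, j')}"
      obtain i1 j1 i2 j2 where xx: "x = ((i1, j1), (i2, j2))" by (metis surj_pair)
      from x jj' have "i1 = i2 \<and> j1 = j \<and> j2 = j' \<or> i1 = Suc i2 \<and> j1 = j' \<and> j2 = j"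
        unfolding xx by (auto simp: Inv_def attack_def precedes_def min_def max_def split: if_splits)
      with x show "x \<in> (\<lambda>i. ((i, j), (i, j'))) ` ?A \<union> (\<lambda>i. ((Suc i, j'), (i, j))) ` ?B"
        unfolding xx by (auto simp: Inv_def)
    qed (use jj' in \<open>auto simp: Inv_def attack_def precedes_def\<close>)
    moreover have "card ((\<lambda>i. ((i, j), (i, j'))) ` ?A \<union> (\<lambda>i. ((Suc i, j'), (i, j))) ` ?B) =
        card ((\<lambda>i. ((i, j), (i, j'))) ` ?A) + card ((\<lambda>i. ((Suc i, j'), (i, j))) ` ?B)"
      using fin jj' by (intro card_Un_disjoint) auto
    moreover have "card ((\<lambda>i. ((i, j), (i, j'))) ` ?A) = card ?A"
      by (intro card_image) (auto simp: inj_on_def)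
    moreover have "card ((\<lambda>i. ((Suc i, j'), (i, j))) ` ?B) = card ?B"
      by (intro card_image) (auto simp: inj_on_def)
    ultimately show "card {x \<in> ?I. ?g x = (j, j')} = card ?A + card ?B" by (simp only:)
  qed
  finally show ?thesis .
qed

lemma sum_indicator_card: "finite A \<Longrightarrow> (\<Sum>x\<in>A. if P x then 1 else 0) = card {x \<in> A. P x}"
  by (simp add: sum.If_cases Int_def)

text \<open>Column pairs are long-long (\<open>P1\<close>), long-short (\<open>P2\<close>) or
  short-short (\<open>P3\<close>). Diagonal inversions need two long columns, since the right-hand
  cell lies below the top row.\<close>

lemma card_Inv_filling_of:
  assumes n: "n \<ge> 2" and w: "a \<in> words n k" "b \<in> words n k"
  shows "card (Inv (k_theta n k) (filling_of n k a b)) =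
     (n - 2) * card {(j, j'). j < j' \<and> j' < k} + word_asc a + word_asc b + count_list a 1 * count_list b 1"
proof -
  let ?d = "dg (k_theta n k)"
  define F where "F = filling_of n k a b"
  define c where "c = (\<lambda>(j, j'). card {i. (i, j) \<in> ?d \<and> (i, j') \<in> ?d \<and> F (i, j') < F (i, j)} +
    card {i. (i, j) \<in> ?d \<and> (Suc i, j') \<in> ?d \<and> F (i, j) < F (Suc i, j')})"
  define P1 where "P1 = {(j, j'). j < j' \<and> j' < k}"
  define P2 where "P2 = {..<k} \<times> {k..<2 * k}"
  define P3 where "P3 = {(j, j'). k \<le> j \<and> j < j' \<and> j' < 2 * k}"
  have len: "length a = k" "length b = k" using w by (auto simp: words_def)
  have fin: "finite P1" "finite P2" "finite P3"
    unfolding P1_def P2_def P3_def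
    by (auto intro: finite_subset[of _ "{..<k} \<times> {..<k}"] finite_subset[of _ "{..<2 * k} \<times> {..<2 * k}"])
  have "card (Inv (k_theta n k) F) = sum c {(j, j'). j < j' \<and> j' < 2 * k}"
    unfolding card_Inv_eq_sum[OF n] c_def ..
  also have "{(j, j'). j < j' \<and> j' < 2 * k} = P1 \<union> P2 \<union> P3"
    by (auto simp: P1_def P2_def P3_def)
  also have "sum c (P1 \<union> P2 \<union> P3) = sum c P1 + sum c P2 + sum c P3"
    using fin by (subst sum.union_disjoint sum.union_disjoint; auto simp: P1_def P2_def P3_def)+
  also have "sum c P1 = (\<Sum>p\<in>P1. (n - 2) + (if a ! fst p < a ! snd p then 1 else 0))"
  proof (rule sum.cong, simp, clarify)
    fix j j' assume "(j, j') \<in> P1"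
    then have j: "j < j'" "j < k" "j' < k" by (auto simp: P1_def)
    then have "{i. (i, j) \<in> ?d \<and> (i, j') \<in> ?d \<and> F (i, j') < F (i, j)} =
        {i. i < n - 1 \<and> omit_entry (a ! j') i < omit_entry (a ! j) i}"
      using n by (auto simp: dg_k_theta F_def filling_of_left)
    moreover have "{i. (i, j) \<in> ?d \<and> (Suc i, j') \<in> ?d \<and> F (i, j) < F (Suc i, j')} =
        {i. Suc i < n - 1 \<and> omit_entry (a ! j) i < omit_entry (a ! j') (Suc i)}"
      using n j by (auto simp: dg_k_theta F_def filling_of_left)
    ultimately show "c (j, j') = (n - 2) + (if a ! fst (j, j') < a ! snd (j, j') then 1 else 0)"
      using card_column_pair_inversions[OF n, of "a ! j" "a ! j'"] words_nth[OF w(1)] j by (simp add: c_def)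
  qed
  also have "\<dots> = (n - 2) * card P1 + word_asc a"
  proof -
    have "{p \<in> P1. a ! fst p < a ! snd p} = {(j, j'). j < j' \<and> j' < length a \<and> a ! j < a ! j'}"
      by (auto simp: P1_def len)
    then show ?thesis
      using fin(1) by (simp add: sum.distrib sum_indicator_card word_asc_eq_card)
  qed
  \<comment> \<open>The top of a long column is 1, or 2 if the missing letter is 1. It exceeds a
    short entry only if the missing letter and that entry are both 1.\<close>
  also have "sum c P2 = (\<Sum>p\<in>P2. if a ! fst p = 1 \<and> b ! (2 * k - 1 - snd p) = 1 then 1 else 0)"
  proof (rule sum.cong, simp, clarify)
    fix j j' assume "(j, j') \<in> P2"
    then have j: "j < k" "k \<le> j'" "j' < 2 * k" by (auto simp: P2_def)
    have pos: "1 \<le> a ! j" "1 \<le> b ! (2 * k - 1 - j')"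
      using words_nth[OF w(1), of j] words_nth[OF w(2), of "2 * k - 1 - j'"] j by auto
    have "{i. (i, j) \<in> ?d \<and> (i, j') \<in> ?d \<and> F (i, j') < F (i, j)} =
        (if a ! j = 1 \<and> b ! (2 * k - 1 - j') = 1 then {0} else {})"
      using n j pos by (auto simp: dg_k_theta F_def filling_of_left filling_of_right omit_entry_def split: if_splits)
    moreover have "{i. (i, j) \<in> ?d \<and> (Suc i, j') \<in> ?d \<and> F (i, j) < F (Suc i, j')} = {}"
      using n j by (auto simp: dg_k_theta)
    ultimately show "c (j, j') = (if a ! fst (j, j') = 1 \<and> b ! (2 * k - 1 - snd (j, j')) = 1 then 1 else 0)"
      unfolding c_def prod.case fst_conv snd_conv by (simp only:) simp
  qed
  also have "\<dots> = card {p \<in> P2. a ! fst p = 1 \<and> b ! (2 * k - 1 - snd p) = 1}"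
    using fin(2) by (rule sum_indicator_card)
  also have "{p \<in> P2. a ! fst p = 1 \<and> b ! (2 * k - 1 - snd p) = 1} =
      {j. j < length a \<and> a ! j = 1} \<times> (\<lambda>j. 2 * k - 1 - j) ` {j. j < length b \<and> b ! j = 1}"
  proof -
    have "{j'. k \<le> j' \<and> j' < 2 * k \<and> b ! (2 * k - 1 - j') = 1} = (\<lambda>j. 2 * k - 1 - j) ` {j. j < length b \<and> b ! j = 1}"
    proof (intro subset_antisym subsetI)
      fix j' assume "j' \<in> {j'. k \<le> j' \<and> j' < 2 * k \<and> b ! (2 * k - 1 - j') = 1}"
      then show "j' \<in> (\<lambda>j. 2 * k - 1 - j) ` {j. j < length b \<and> b ! j = 1}"
        using len by (intro image_eqI[of _ _ "2 * k - 1 - j'"]) auto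
    next
      fix j' assume "j' \<in> (\<lambda>j. 2 * k - 1 - j) ` {j. j < length b \<and> b ! j = 1}"
      then obtain j where "j' = 2 * k - 1 - j" "j < k" "b ! j = 1" using len by auto
      then show "j' \<in> {j'. k \<le> j' \<and> j' < 2 * k \<and> b ! (2 * k - 1 - j') = 1}" by auto
    qed
    then show ?thesis by (auto simp: P2_def len)
  qed
  also have "card \<dots> = count_list a 1 * count_list b 1"
  proof -
    have "card ((\<lambda>j. 2 * k - 1 - j) ` {j. j < length b \<and> b ! j = 1}) = card {j. j < length b \<and> b ! j = 1}"
      by (intro card_image) (use len in \<open>auto simp: inj_on_def\<close>)
    then show ?thesis by (simp add: card_cartesian_product count_list_eq_card)
  qed
  \<comment> \<open>Since \<open>b\<close> is read from the right, a drop from column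
    \<open>j\<close> to column \<open>j'\<close> is an ascent of \<open>b\<close>.\<close>
  also have "sum c P3 = (\<Sum>p\<in>P3. if b ! (2 * k - 1 - snd p) < b ! (2 * k - 1 - fst p) then 1 else 0)"
  proof (rule sum.cong, simp, clarify)
    fix j j' assume "(j, j') \<in> P3"
    then have j: "k \<le> j" "j < j'" "j' < 2 * k" by (auto simp: P3_def)
    have "{i. (i, j) \<in> ?d \<and> (i, j') \<in> ?d \<and> F (i, j') < F (i, j)} =
        (if b ! (2 * k - 1 - j') < b ! (2 * k - 1 - j) then {0} else {})"
      using n j by (auto simp: dg_k_theta F_def filling_of_right split: if_splits)
    moreover have "{i. (i, j) \<in> ?d \<and> (Suc i, j') \<in> ?d \<and> F (i, j) < F (Suc i, j')} = {}"
      using n j by (auto simp: dg_k_theta)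
    ultimately show "c (j, j') = (if b ! (2 * k - 1 - snd (j, j')) < b ! (2 * k - 1 - fst (j, j')) then 1 else 0)"
      unfolding c_def prod.case fst_conv snd_conv by (simp only:) simp
  qed
  also have "\<dots> = card {p \<in> P3. b ! (2 * k - 1 - snd p) < b ! (2 * k - 1 - fst p)}"
    using fin(3) by (rule sum_indicator_card)
  also have "\<dots> = word_asc b"
    unfolding word_asc_eq_card
    by (rule bij_betw_same_card[of "\<lambda>(j, j'). (2 * k - 1 - j', 2 * k - 1 - j)"],
        rule bij_betw_byWitness[of _ "\<lambda>(j, j'). (2 * k - 1 - j', 2 * k - 1 - j)"])
       (auto simp: P3_def len)
  finally show ?thesis by (simp add: F_def P1_def)
qed

text \<open>Columns increase, so every cell below the top row is a descent. The arms of these cells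
  add up to \<open>n - 2\<close> times the number of pairs of long columns, cancelling the first
  term of \<open>card_Inv_filling_of\<close>.\<close>

lemma inv_stat_filling_of:
  assumes n: "n \<ge> 2" and w: "a \<in> words n k" "b \<in> words n k"
  shows "inv_stat (k_theta n k) (filling_of n k a b) =
     int (word_asc a + word_asc b + count_list a 1 * count_list b 1)"
proof -
  let ?d = "dg (k_theta n k)"
  have Des: "Des (k_theta n k) (filling_of n k a b) = {1..<n - 1} \<times> {..<k}"
    using n by (auto simp: Des_def dg_k_theta filling_of_left omit_entry_mono)
  have "arm (k_theta n k) (i, j) = card {j<..<k}" if "1 \<le> i" "i < n - 1" for i j
    unfolding arm_def using n that by (intro arg_cong[of _ _ card]) (auto simp: dg_k_theta)
  then have "(\<Sum>u\<in>Des (k_theta n k) (filling_of n k a b). int (arm (k_theta n k) u)) =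
      (\<Sum>(i, j)\<in>{1..<n - 1} \<times> {..<k}. int (card {j<..<k}))"
    unfolding Des by (intro sum.cong) auto
  also have "\<dots> = int ((n - 2) * (\<Sum>j<k. card {j<..<k}))"
    unfolding sum.cartesian_product[symmetric] by (simp add: numeral_2_eq_2)
  also have "(\<Sum>j<k. card {j<..<k}) = card (SIGMA j:{..<k}. {j<..<k})"
    by (rule card_SigmaI[symmetric]) auto
  also have "(SIGMA j:{..<k}. {j<..<k}) = {(j, j'). j < j' \<and> j' < k}" by auto
  finally show ?thesis
    unfolding inv_stat_def card_Inv_filling_of[OF assms] by simp
qed

section \<open>Telescoping\<close>

text \<open>Counts all ordered pairs of positions: equal letters give the sum of squares, and each
  ascent or descent is counted in both orders.\<close>

lemma word_asc_desc:
  assumes "finite A" "set w \<subseteq> A"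
  shows "2 * word_asc w + 2 * word_desc w + (\<Sum>i\<in>A. (count_list w i)\<^sup>2) = (length w)\<^sup>2"
  using assms(2)
proof (induction w)
  case (Cons c w)
  have 1: "length (filter (\<lambda>x. c < x) w) + length (filter (\<lambda>x. x < c) w) + count_list w c = length w"
    by (induction w) auto
  have "(\<Sum>i\<in>A. (count_list (c # w) i)\<^sup>2) =
      (\<Sum>i\<in>A. (count_list w i)\<^sup>2 + (if c = i then 2 * count_list w i + 1 else 0))"
    by (intro sum.cong) (auto simp: power2_eq_square)
  also have "\<dots> = (\<Sum>i\<in>A. (count_list w i)\<^sup>2) + (2 * count_list w c + 1)"
    using assms(1) Cons.prems by (subst sum.distrib) simp
  finally show ?case
    using Cons 1 by (simp add: power2_eq_square algebra_simps)
qed simp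

definition pair_exponent :: "nat list \<Rightarrow> nat list \<Rightarrow> int" where
  "pair_exponent a b = int (length a) ^ 2 - int (word_asc a + word_asc b + count_list a 1 * count_list b 1)"

text \<open>Modulo the relation that the product of all variables is 1, a column without the letter
  \<open>i\<close> contributes the inverse of the variable of \<open>i\<close>; hence the
  sign.\<close>

definition pair_weight :: "nat list \<Rightarrow> nat list \<Rightarrow> nat \<Rightarrow> int" where
  "pair_weight a b i = int (count_list b i) - int (count_list a i)"

definition pair_term :: "nat \<Rightarrow> nat list \<Rightarrow> nat list \<Rightarrow> (weight \<Rightarrow>\<^sub>0 int) fls" where
  "pair_term n a b = fls_const (x_monomial n (pair_weight a b)) * fls_X_intpow (pair_exponent a b)"

lemma word_asc_Cons_1:
  assumes "w \<in> words n k"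
  shows "word_asc (1 # w) + count_list w 1 = k + word_asc w"
proof -
  have "0 \<notin> set w" "length w = k" using assms by (auto simp: words_def)
  moreover have "0 \<notin> set w \<Longrightarrow> length (filter ((<) 1) w) + count_list w 1 = length w"
    by (induction w) auto
  ultimately show ?thesis by simp
qed

text \<open>If \<open>a\<close>, \<open>b\<close> contain r and s ones, the squared length grows by
  2k + 1, the ascents by 2k - r - s, and the product of the numbers of ones by r + s + 1, so the
  exponent is unchanged.\<close>

lemma pair_term_Cons_1:
  assumes "a \<in> words n k" "b \<in> words n k"
  shows "pair_term n (1 # a) (1 # b) = pair_term n a b"
proof -
  have "int (word_asc (1 # a)) + int (count_list a 1) = int k + int (word_asc a)"
    "int (word_asc (1 # b)) + int (count_list b 1) = int k + int (word_asc b)"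
    using word_asc_Cons_1[OF assms(1)] word_asc_Cons_1[OF assms(2)] by linarith+
  moreover have "length a = k" using assms by (simp add: words_def)
  ultimately have "pair_exponent (1 # a) (1 # b) = pair_exponent a b"
    by (simp add: pair_exponent_def power2_eq_square algebra_simps del: word_asc.simps)
  moreover have "pair_weight (1 # a) (1 # b) = pair_weight a b"
    by (auto simp: pair_weight_def)
  ultimately show ?thesis by (simp add: pair_term_def)
qed

section \<open>Weights of fillings\<close>

lemma weight_of_add:
  assumes "n \<ge> 2"
  shows "weight_of n (\<lambda>i. \<gamma> i + \<delta> i) = weight_of n \<gamma> + weight_of n \<delta>"
  by (rule poly_mapping_eqI) (simp add: lookup_weight_of[OF assms] lookup_add)

lemma x_monomial_add:
  assumes "n \<ge> 2"
  shows "x_monomial n (\<lambda>i. \<gamma> i + \<delta> i) = x_monomial n \<gamma> * x_monomial n \<delta>"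
  by (simp add: x_monomial_def weight_of_add[OF assms] mult_single)

lemma x_monomial_0: "n \<ge> 2 \<Longrightarrow> x_monomial n (\<lambda>i. 0) = 1"
  using prod_x_power[of n "\<lambda>i. 0"] by simp

lemma x_var_eq_x_monomial:
  assumes "n \<ge> 2" "1 \<le> c" "c \<le> n"
  shows "x_var n c = x_monomial n (\<lambda>i. if i = c then 1 else 0)"
proof -
  have "(\<Prod>i=1..n. x_var n i ^ (if i = c then 1 else 0)) = (\<Prod>i=1..n. if i = c then x_var n c else 1)"
    by (intro prod.cong) auto
  also have "\<dots> = x_var n c" using assms by simp
  finally have "x_var n c = x_monomial n (\<lambda>i. int (if i = c then 1 else 0))"
    using prod_x_power[of n "\<lambda>i. if i = c then 1 else 0"] by simp
  then show ?thesis by (simp add: if_distrib cong: if_cong)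
qed

lemma prod_x_var_omit_entry:
  assumes n: "n \<ge> 2" and a: "1 \<le> a" "a \<le> n"
  shows "(\<Prod>i<n - 1. x_var n (omit_entry a i)) = x_monomial n (\<lambda>i. - (if i = a then 1 else 0))"
proof -
  let ?P = "\<Prod>i<n - 1. x_var n (omit_entry a i)"
  have "omit_entry a ` {..<n - 1} = {1..n} - {a}"
  proof (intro subset_antisym subsetI)
    fix i assume "i \<in> {1..n} - {a}"
    then show "i \<in> omit_entry a ` {..<n - 1}"
      using a by (intro image_eqI[of _ _ "if i < a then i - 1 else i - 2"]) (auto simp: omit_entry_def)
  qed (auto simp: omit_entry_def split: if_splits)
  moreover have "inj_on (omit_entry a) {..<n - 1}"
    using omit_entry_mono by (metis linorder_inj_onI' less_irrefl)
  ultimately have "?P = (\<Prod>i\<in>{1..n} - {a}. x_var n i)"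
    using prod.reindex[of "omit_entry a" "{..<n - 1}" "x_var n"] by (simp add: comp_def)
  then have 1: "x_var n a * ?P = 1"
    using prod_x[OF n] prod.remove[of "{1..n}" a "x_var n"] a by simp
  have "x_monomial n (\<lambda>i. (if i = a then 1 else 0) + - (if i = a then 1 else 0)) = 1"
    using x_monomial_0[OF n] by simp
  then have 2: "x_var n a * x_monomial n (\<lambda>i. - (if i = a then 1 else 0)) = 1"
    unfolding x_monomial_add[OF n] x_var_eq_x_monomial[OF n a] .
  let ?Q = "x_monomial n (\<lambda>i. - (if i = a then 1 else 0))"
  \<comment> \<open>Both \<open>?P\<close> and \<open>?Q\<close> are inverse to
    \<open>x_var n a\<close>, and inverses are unique.\<close>
  have "?P = (x_var n a * ?Q) * ?P" unfolding 2 by simp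
  also have "\<dots> = (x_var n a * ?P) * ?Q" by (simp only: mult_ac)
  finally show ?thesis unfolding 1 by simp
qed

text \<open>The sign \<open>s\<close> serves both words: -1 for the missing letters in
  \<open>a\<close>, 1 for the entries in \<open>b\<close>.\<close>

lemma prod_list_map_x_monomial:
  assumes "n \<ge> 2"
  shows "prod_list (map (\<lambda>c. x_monomial n (\<lambda>i. s * (if i = c then 1 else 0))) w) =
     x_monomial n (\<lambda>i. s * int (count_list w i))"
proof (induction w)
  case (Cons c w)
  have "(\<lambda>i. s * int (count_list (c # w) i)) = (\<lambda>i. s * (if i = c then 1 else 0) + s * int (count_list w i))"
    by (auto simp: algebra_simps)
  then show ?case using Cons by (simp add: x_monomial_add[OF assms])
qed (simp add: x_monomial_0[OF assms])

lemma x_filling_filling_of: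
  assumes n: "n \<ge> 2" and w: "a \<in> words n k" "b \<in> words n k"
  shows "x_filling n (k_theta n k) (filling_of n k a b) = x_monomial n (pair_weight a b)"
proof -
  let ?F = "filling_of n k a b"
  have len: "length a = k" "length b = k" using w by (auto simp: words_def)
  \<comment> \<open>Long columns are indexed column first, so that the inner product runs over one
    column; short columns are indexed by positions in \<open>b\<close>.\<close>
  have dg: "dg (k_theta n k) = (\<lambda>(j, i). (i, j)) ` ({..<k} \<times> {..<n - 1}) \<union> (\<lambda>j. (0, 2 * k - 1 - j)) ` {..<k}"
  proof (intro subset_antisym subsetI)
    fix c assume "c \<in> dg (k_theta n k)"
    moreover obtain i j where c: "c = (i, j)" by force
    ultimately have "i < n - 1 \<and> j < k \<or> i = 0 \<and> j < 2 * k \<and> k \<le> j"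
      using n by (cases "j < k") (auto simp: dg_k_theta)
    then show "c \<in> (\<lambda>(j, i). (i, j)) ` ({..<k} \<times> {..<n - 1}) \<union> (\<lambda>j. (0, 2 * k - 1 - j)) ` {..<k}"
    proof (elim disjE)
      assume "i = 0 \<and> j < 2 * k \<and> k \<le> j"
      then have "c \<in> (\<lambda>j. (0, 2 * k - 1 - j)) ` {..<k}"
        using c by (intro image_eqI[of _ _ "2 * k - 1 - j"]) auto
      then show ?thesis by simp
    qed (use c in auto)
  qed (use n in \<open>auto simp: dg_k_theta\<close>)
  have "x_filling n (k_theta n k) ?F = (\<Prod>c\<in>(\<lambda>(j, i). (i, j)) ` ({..<k} \<times> {..<n - 1}). x_var n (?F c)) *
      (\<Prod>c\<in>(\<lambda>j. (0, 2 * k - 1 - j)) ` {..<k}. x_var n (?F c))"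
    unfolding x_filling_def dg by (rule prod.union_disjoint) auto
  also have "(\<Prod>c\<in>(\<lambda>(j, i). (i, j)) ` ({..<k} \<times> {..<n - 1}). x_var n (?F c)) =
      (\<Prod>(j, i)\<in>{..<k} \<times> {..<n - 1}. x_var n (omit_entry (a ! j) i))"
  proof (rule prod.reindex_cong[of "\<lambda>(j, i). (i, j)"])
    show "inj_on (\<lambda>(j, i). (i, j)) ({..<k} \<times> {..<n - 1})" by (auto simp: inj_on_def)
  next
    fix p assume p: "p \<in> {..<k} \<times> {..<n - 1}"
    obtain j i where ji: "p = (j, i)" by force
    show "x_var n (?F (case p of (j, i) \<Rightarrow> (i, j))) = (case p of (j, i) \<Rightarrow> x_var n (omit_entry (a ! j) i))"
      using p filling_of_left[OF n, of i j k a b] unfolding ji by simp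
  qed (rule refl)
  also have "\<dots> = (\<Prod>j<k. \<Prod>i<n - 1. x_var n (omit_entry (a ! j) i))"
    by (simp add: prod.cartesian_product)
  also have "\<dots> = (\<Prod>j<k. x_monomial n (\<lambda>i. (-1) * (if i = a ! j then 1 else 0)))"
  proof (rule prod.cong)
    fix j assume "j \<in> {..<k}"
    then show "(\<Prod>i<n - 1. x_var n (omit_entry (a ! j) i)) = x_monomial n (\<lambda>i. (-1) * (if i = a ! j then 1 else 0))"
      using prod_x_var_omit_entry[OF n, of "a ! j"] words_nth[OF w(1), of j] by simp
  qed simp
  also have "\<dots> = x_monomial n (\<lambda>i. (-1) * int (count_list a i))"
    unfolding prod_list_map_x_monomial[OF n, symmetric] prod.list_conv_set_nth
    by (simp add: len atLeast0LessThan)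
  also have "(\<Prod>c\<in>(\<lambda>j. (0, 2 * k - 1 - j)) ` {..<k}. x_var n (?F c)) =
      (\<Prod>j<k. x_monomial n (\<lambda>i. 1 * (if i = b ! j then 1 else 0)))"
  proof -
    have "inj_on (\<lambda>j. (0::nat, 2 * k - 1 - j)) {..<k}" by (auto simp: inj_on_def)
    moreover have "x_var n (?F (0, 2 * k - 1 - j)) = x_monomial n (\<lambda>i. 1 * (if i = b ! j then 1 else 0))"
      if "j < k" for j
      using that n words_nth[OF w(2) that] by (simp add: filling_of_right x_var_eq_x_monomial)
    ultimately show ?thesis by (subst prod.reindex) (auto intro!: prod.cong)
  qed
  also have "\<dots> = x_monomial n (\<lambda>i. 1 * int (count_list b i))"
    unfolding prod_list_map_x_monomial[OF n, symmetric] prod.list_conv_set_nth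
    by (simp add: len atLeast0LessThan)
  finally show ?thesis
    unfolding x_monomial_add[OF n, symmetric] by (simp add: pair_weight_def[abs_def])
qed

text \<open>\<open>W k - B k\<close> corresponds to \<open>C_fillings n k\<close>, and prefixing 1
  to both words carries \<open>W k\<close> onto \<open>B (Suc k)\<close> without changing the terms.
  Each contribution is thus a difference of consecutive sums over \<open>W\<close>, starting from
  \<open>B 0 = {}\<close>.\<close>

lemma partial_sum_C_fillings:
  assumes n: "n \<ge> 2"
  shows "(\<Sum>k\<le>K. \<Sum>F\<in>C_fillings n k. fls_const (x_filling n (k_theta n k) F) *
            fls_X_intpow (int k ^ 2 - inv_stat (k_theta n k) F)) =
     (\<Sum>(a, b)\<in>words n K \<times> words n K. pair_term n a b)"
proof -
  define W where "W k = words n k \<times> words n k" for k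
  define B where "B k = {p \<in> W k. k > 0 \<and> hd (fst p) = 1 \<and> hd (snd p) = 1}" for k
  have fin: "finite (W k)" for k by (simp add: W_def finite_words)
  have C: "(\<Sum>F\<in>C_fillings n k. fls_const (x_filling n (k_theta n k) F) *
            fls_X_intpow (int k ^ 2 - inv_stat (k_theta n k) F)) = (\<Sum>(a, b)\<in>W k - B k. pair_term n a b)" for k
  proof -
    have "bij_betw (\<lambda>(a, b). filling_of n k a b) (W k - B k) (C_fillings n k)"
    proof (rule bij_betw_subset[OF bij_betw_filling_of[OF n]])
      show "(\<lambda>(a, b). filling_of n k a b) ` (W k - B k) = C_fillings n k"
      proof (intro subset_antisym subsetI)
        fix F assume F: "F \<in> C_fillings n k"
        then have "F \<in> (\<lambda>(a, b). filling_of n k a b) ` W k"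
          unfolding W_def bij_betw_imp_surj_on[OF bij_betw_filling_of[OF n]] by (simp add: C_fillings_def)
        with F show "F \<in> (\<lambda>(a, b). filling_of n k a b) ` (W k - B k)"
          using n by (auto simp: W_def B_def filling_of_in_C_fillings_iff)
      qed (use n in \<open>auto simp: W_def B_def filling_of_in_C_fillings_iff\<close>)
    qed (auto simp: W_def)
    then show ?thesis
      by (rule sum.reindex_bij_betw[symmetric, THEN trans])
         (use n in \<open>auto simp: W_def words_def pair_term_def pair_exponent_def inv_stat_filling_of x_filling_filling_of intro!: sum.cong\<close>)
  qed
  have B: "(\<Sum>(a, b)\<in>B (Suc k). pair_term n a b) = (\<Sum>(a, b)\<in>W k. pair_term n a b)" for k
  proof (rule sum.reindex_bij_witness[of _ "map_prod ((#) 1) ((#) 1)" "map_prod tl tl"], goal_cases)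
    case (5 p)
    then obtain a b where p: "p = (1 # a, 1 # b)" "a \<in> words n k" "b \<in> words n k"
      by (auto simp: B_def W_def words_def length_Suc_conv)
    show ?case using pair_term_Cons_1[OF p(2,3)] by (simp add: p(1))
  qed (use n in \<open>auto simp: B_def W_def words_def length_Suc_conv\<close>)
  have split: "(\<Sum>(a, b)\<in>W k. pair_term n a b) = (\<Sum>(a, b)\<in>W k - B k. pair_term n a b) + (\<Sum>(a, b)\<in>B k. pair_term n a b)" for k
    by (rule sum.subset_diff[OF _ fin]) (auto simp: B_def)
  show ?thesis
    unfolding C W_def[symmetric]
  proof (induction K)
    case 0
    have "B 0 = {}" by (simp add: B_def)
    then show ?case by simp
  next
    case (Suc K)
    then show ?case by (simp add: split[of "Suc K"] B)
  qed
qed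

section \<open>The limit\<close>

definition contents :: "nat \<Rightarrow> nat \<Rightarrow> (nat \<Rightarrow> nat) set" where
  "contents n k = {\<alpha> \<in> {1..n} \<rightarrow>\<^sub>E UNIV. sum \<alpha> {1..n} = k}"

lemma finite_contents: "finite (contents n k)"
proof (rule finite_subset)
  show "contents n k \<subseteq> {1..n} \<rightarrow>\<^sub>E {..k}"
  proof
    fix \<alpha> assume \<alpha>: "\<alpha> \<in> contents n k"
    then have "\<alpha> i \<le> k" if "i \<in> {1..n}" for i
      using member_le_sum[of i "{1..n}" \<alpha>] that by (auto simp: contents_def)
    with \<alpha> show "\<alpha> \<in> {1..n} \<rightarrow>\<^sub>E {..k}" by (auto simp: contents_def PiE_iff)
  qed
qed (auto intro: finite_PiE)

definition content_gf :: "nat \<Rightarrow> (nat \<Rightarrow> nat) \<Rightarrow> 'a::comm_ring_1 fps" where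
  "content_gf n \<alpha> = (\<Sum>w\<in>words_with_content {1..n} \<alpha>. fps_X ^ word_desc w)"

lemma sum_words_by_content:
  "(\<Sum>w\<in>words n k. h w) = (\<Sum>\<alpha>\<in>contents n k. \<Sum>w\<in>words_with_content {1..n} \<alpha>. h w)"
proof -
  let ?g = "\<lambda>w. restrict (count_list w) {1..n}"
  have "?g ` words n k \<subseteq> contents n k"
    by (auto simp: contents_def words_def sum_count_set)
  from sum.group[OF finite_words finite_contents this, of h]
  have "(\<Sum>w\<in>words n k. h w) = (\<Sum>\<alpha>\<in>contents n k. \<Sum>w\<in>{w \<in> words n k. ?g w = \<alpha>}. h w)" by simp
  also have "\<dots> = (\<Sum>\<alpha>\<in>contents n k. \<Sum>w\<in>words_with_content {1..n} \<alpha>. h w)"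
  proof (rule sum.cong)
    fix \<alpha> assume \<alpha>: "\<alpha> \<in> contents n k"
    have "{w \<in> words n k. ?g w = \<alpha>} = words_with_content {1..n} \<alpha>"
    proof (intro subset_antisym subsetI)
      fix w assume w: "w \<in> words_with_content {1..n} \<alpha>"
      then have "length w = k" using length_words_with_content[OF _ w] \<alpha> by (simp add: contents_def)
      moreover have "?g w = \<alpha>"
      proof
        fix i
        show "?g w i = \<alpha> i"
          using w \<alpha> by (cases "i \<in> {1..n}") (auto simp: words_with_content_def contents_def PiE_iff extensional_def)
      qed
      ultimately show "w \<in> {w \<in> words n k. ?g w = \<alpha>}"
        using w by (simp add: words_with_content_def words_def)
    qed (auto simp: words_with_content_def words_def)
    then show "(\<Sum>w\<in>{w \<in> words n k. ?g w = \<alpha>}. h w) = (\<Sum>w\<in>words_with_content {1..n} \<alpha>. h w)" by simp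
  qed simp
  finally show ?thesis .
qed

text \<open>\<open>content_gf\<close> is a q-multinomial coefficient, (q)_k over the product of the
  symbols of all letters. As \<open>d \<le> \<alpha> 1 \<le> k\<close>, the numerator cancels
  against the symbol of the letter 1 modulo \<open>X^(d+1)\<close>.\<close>

lemma fps_agree_content_gf:
  assumes n: "n \<ge> 2" and \<alpha>: "\<alpha> \<in> contents n k" and d: "d \<le> \<alpha> 1"
  shows "fps_agree d (content_gf n \<alpha>) (\<Prod>i=2..n. qpoch_inv (\<alpha> i) :: 'a::comm_ring_1 fps)"
proof -
  let ?Q = "\<Prod>i=2..n. qpoch (\<alpha> i) :: 'a fps" and ?P = "\<Prod>i=2..n. qpoch_inv (\<alpha> i) :: 'a fps"
  have interval: "{1..n} = insert 1 {2..n}" using n by auto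
  have sum: "sum \<alpha> {1..n} = k" using \<alpha> by (simp add: contents_def)
  have "\<alpha> 1 \<le> k" using sum unfolding interval by simp
  have "content_gf n \<alpha> * (qpoch (\<alpha> 1) * ?Q) = (qpoch k :: 'a fps)"
    using macmahon_word_desc[of "{1..n}" \<alpha>, where 'a = 'a] unfolding sum content_gf_def unfolding interval by simp
  then have "(content_gf n \<alpha> * (qpoch (\<alpha> 1) * ?Q)) * (qpoch_inv (\<alpha> 1) * ?P) = (qpoch k * (qpoch_inv (\<alpha> 1) * ?P) :: 'a fps)"
    by (simp only:)
  moreover have "(content_gf n \<alpha> * (qpoch (\<alpha> 1) * ?Q)) * (qpoch_inv (\<alpha> 1) * ?P) =
     content_gf n \<alpha> * ((qpoch (\<alpha> 1) * qpoch_inv (\<alpha> 1)) * (?Q * ?P))"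
    by (simp only: mult_ac)
  moreover have "?Q * ?P = 1"
    unfolding prod.distrib[symmetric] qpoch_mult_inv by simp
  ultimately have eq: "content_gf n \<alpha> = (qpoch k * (qpoch_inv (\<alpha> 1) * ?P) :: 'a fps)"
    by (simp add: qpoch_mult_inv)
  have "fps_agree d (qpoch k * (qpoch_inv (\<alpha> 1) * ?P)) (qpoch (\<alpha> 1) * (qpoch_inv (\<alpha> 1) * ?P))"
    by (intro fps_agree_mult fps_agree_refl fps_agree_qpoch) (use d \<open>\<alpha> 1 \<le> k\<close> in auto)
  also have "qpoch (\<alpha> 1) * (qpoch_inv (\<alpha> 1) * ?P) = ?P"
    by (simp add: mult.assoc[symmetric] qpoch_mult_inv)
  finally show ?thesis unfolding eq .
qed

text \<open>The restriction makes this an element of \<open>root_lattice\<close>, whose members are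
  extensional.\<close>

definition content_diff :: "nat \<Rightarrow> (nat \<Rightarrow> nat) \<Rightarrow> (nat \<Rightarrow> nat) \<Rightarrow> nat \<Rightarrow> int" where
  "content_diff n \<alpha> \<beta> = restrict (\<lambda>i. int (\<beta> i) - int (\<alpha> i)) {1..n}"

lemma content_diff_root_lattice:
  assumes "\<alpha> \<in> contents n k" "\<beta> \<in> contents n k"
  shows "content_diff n \<alpha> \<beta> \<in> root_lattice n"
proof -
  have "(\<Sum>i=1..n. int (\<beta> i) - int (\<alpha> i)) = int (sum \<beta> {1..n}) - int (sum \<alpha> {1..n})"
    by (simp add: sum_subtractf)
  also have "\<dots> = 0" using assms by (simp add: contents_def del: of_nat_sum)
  finally show ?thesis using assms by (simp add: content_diff_def root_lattice_def contents_def)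
qed

lemma x_monomial_cong:
  "(\<And>i. i \<in> {1..n} \<Longrightarrow> \<gamma> i = \<delta> i) \<Longrightarrow> x_monomial n \<gamma> = x_monomial n \<delta>"
  by (simp add: x_monomial_def weight_of_def)

text \<open>\<open>word_asc_desc\<close> for both words trades ascents for descents and squares.
  Completing the square of \<beta> - \<alpha> leaves the inner product of \<alpha> and \<beta>,
  whose term at the letter 1 cancels the product of the numbers of ones. In particular the exponent
  is nonnegative.\<close>

lemma pair_exponent_eq:
  assumes n: "n \<ge> 2" and \<alpha>\<beta>: "\<alpha> \<in> contents n k" "\<beta> \<in> contents n k"
    and ab: "a \<in> words_with_content {1..n} \<alpha>" "b \<in> words_with_content {1..n} \<beta>"
  shows "pair_exponent a b =
    int (half_norm n (content_diff n \<alpha> \<beta>) + (\<Sum>i=2..n. \<alpha> i * \<beta> i) + word_desc a + word_desc b)"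
proof -
  let ?g = "content_diff n \<alpha> \<beta>"
  have interval: "{1..n} = insert 1 {2..n}" using n by auto
  have len: "length a = k" "length b = k"
    using length_words_with_content[OF _ ab(1)] length_words_with_content[OF _ ab(2)] \<alpha>\<beta>
    by (simp_all add: contents_def)
  have count: "count_list a i = \<alpha> i" "count_list b i = \<beta> i" if "i \<in> {1..n}" for i
    using ab that by (auto simp: words_with_content_def)
  have "2 * word_asc a + 2 * word_desc a + (\<Sum>i=1..n. (\<alpha> i)\<^sup>2) = k\<^sup>2"
    using word_asc_desc[of "{1..n}" a] ab(1) by (simp add: words_with_content_def len)
  then have 1: "2 * int (word_asc a) + 2 * int (word_desc a) + (\<Sum>i=1..n. (int (\<alpha> i))\<^sup>2) = (int k)\<^sup>2"
    by (metis (mono_tags, lifting) of_nat_add of_nat_mult of_nat_numeral of_nat_power of_nat_sum sum.cong)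
  have "2 * word_asc b + 2 * word_desc b + (\<Sum>i=1..n. (\<beta> i)\<^sup>2) = k\<^sup>2"
    using word_asc_desc[of "{1..n}" b] ab(2) by (simp add: words_with_content_def len)
  then have 2: "2 * int (word_asc b) + 2 * int (word_desc b) + (\<Sum>i=1..n. (int (\<beta> i))\<^sup>2) = (int k)\<^sup>2"
    by (metis (mono_tags, lifting) of_nat_add of_nat_mult of_nat_numeral of_nat_power of_nat_sum sum.cong)
  have "2 * int (half_norm n ?g) = (\<Sum>i=1..n. (?g i)\<^sup>2)"
    by (rule half_norm[OF content_diff_root_lattice[OF \<alpha>\<beta>]])
  also have "\<dots> = (\<Sum>i=1..n. (int (\<alpha> i))\<^sup>2 + (int (\<beta> i))\<^sup>2 - 2 * (int (\<alpha> i) * int (\<beta> i)))"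
    by (intro sum.cong) (auto simp: content_diff_def power2_eq_square algebra_simps)
  also have "\<dots> = (\<Sum>i=1..n. (int (\<alpha> i))\<^sup>2) + (\<Sum>i=1..n. (int (\<beta> i))\<^sup>2) - 2 * (\<Sum>i=1..n. int (\<alpha> i) * int (\<beta> i))"
    by (simp add: sum.distrib sum_subtractf sum_distrib_left)
  also have "(\<Sum>i=1..n. int (\<alpha> i) * int (\<beta> i)) = int (\<alpha> 1 * \<beta> 1) + int (\<Sum>i=2..n. \<alpha> i * \<beta> i)"
    unfolding interval by simp
  finally show ?thesis
    using 1 2 count[of 1] n by (simp add: pair_exponent_def len)
qed

lemma fps_to_fls_sum: "fps_to_fls (\<Sum>x\<in>A. f x) = (\<Sum>x\<in>A. fps_to_fls (f x :: 'a::comm_ring_1 fps))"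
  by (induction A rule: infinite_finite_induct) simp_all

lemma sum_pair_term:
  assumes n: "n \<ge> 2"
  shows "(\<Sum>(a, b)\<in>words n k \<times> words n k. pair_term n a b) =
    fps_to_fls (\<Sum>(\<alpha>, \<beta>)\<in>contents n k \<times> contents n k.
       fps_X ^ half_norm n (content_diff n \<alpha> \<beta>) * fps_const (x_monomial n (content_diff n \<alpha> \<beta>)) *
       fps_X ^ (\<Sum>i=2..n. \<alpha> i * \<beta> i) * content_gf n \<alpha> * content_gf n \<beta>)"
proof -
  define c where "c \<alpha> \<beta> = fps_X ^ half_norm n (content_diff n \<alpha> \<beta>) *
     fps_const (x_monomial n (content_diff n \<alpha> \<beta>)) * fps_X ^ (\<Sum>i=2..n. \<alpha> i * \<beta> i)" for \<alpha> \<beta>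
  have pair: "pair_term n a b = fps_to_fls (c \<alpha> \<beta> * fps_X ^ word_desc a * fps_X ^ word_desc b)"
    if "\<alpha> \<in> contents n k" "\<beta> \<in> contents n k"
      "a \<in> words_with_content {1..n} \<alpha>" "b \<in> words_with_content {1..n} \<beta>" for a b \<alpha> \<beta>
  proof -
    have wt: "x_monomial n (pair_weight a b) = x_monomial n (content_diff n \<alpha> \<beta>)"
      using that by (intro x_monomial_cong) (auto simp: pair_weight_def content_diff_def words_with_content_def)
    have X: "fls_X_intpow (int m) = fps_to_fls (fps_X ^ m :: (weight \<Rightarrow>\<^sub>0 int) fps)" for m
      by (simp add: fps_to_fls_power fls_X_power_conv_shift_1)
    have "pair_term n a b = fps_to_fls (fps_const (x_monomial n (content_diff n \<alpha> \<beta>)) *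
       fps_X ^ (half_norm n (content_diff n \<alpha> \<beta>) + (\<Sum>i=2..n. \<alpha> i * \<beta> i) + word_desc a + word_desc b))"
      unfolding pair_term_def pair_exponent_eq[OF n that] wt X fls_times_fps_to_fls fps_const_to_fls ..
    also have "fps_const (x_monomial n (content_diff n \<alpha> \<beta>)) *
       fps_X ^ (half_norm n (content_diff n \<alpha> \<beta>) + (\<Sum>i=2..n. \<alpha> i * \<beta> i) + word_desc a + word_desc b) =
       c \<alpha> \<beta> * fps_X ^ word_desc a * fps_X ^ word_desc b"
      unfolding c_def power_add by (simp only: mult_ac)
    finally show ?thesis .
  qed
  have "(\<Sum>(a, b)\<in>words n k \<times> words n k. pair_term n a b) =
     (\<Sum>\<alpha>\<in>contents n k. \<Sum>a\<in>words_with_content {1..n} \<alpha>.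
        \<Sum>\<beta>\<in>contents n k. \<Sum>b\<in>words_with_content {1..n} \<beta>. pair_term n a b)"
    unfolding sum.cartesian_product[symmetric] sum_words_by_content ..
  also have "\<dots> = (\<Sum>\<alpha>\<in>contents n k. \<Sum>\<beta>\<in>contents n k. \<Sum>a\<in>words_with_content {1..n} \<alpha>.
        \<Sum>b\<in>words_with_content {1..n} \<beta>. pair_term n a b)"
    by (intro sum.cong refl sum.swap)
  also have "\<dots> = (\<Sum>\<alpha>\<in>contents n k. \<Sum>\<beta>\<in>contents n k. \<Sum>a\<in>words_with_content {1..n} \<alpha>.
        \<Sum>b\<in>words_with_content {1..n} \<beta>. fps_to_fls (c \<alpha> \<beta> * fps_X ^ word_desc a * fps_X ^ word_desc b))"
    by (intro sum.cong refl pair)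
  also have "\<dots> = fps_to_fls (\<Sum>(\<alpha>, \<beta>)\<in>contents n k \<times> contents n k. c \<alpha> \<beta> * content_gf n \<alpha> * content_gf n \<beta>)"
    unfolding fps_to_fls_sum[symmetric] sum.cartesian_product[symmetric] content_gf_def
    by (simp only: sum_distrib_left sum_distrib_right mult.assoc)
       (rule arg_cong[of _ _ fps_to_fls], rule sum.cong[OF refl], rule sum.cong[OF refl], rule sum.swap)
  finally show ?thesis unfolding c_def .
qed

text \<open>The embedding of power series into Laurent series is an isometry.\<close>

lemma tendsto_fps_to_fls:
  assumes "(f \<longlongrightarrow> g) F"
  shows "((\<lambda>x. fps_to_fls (f x)) \<longlongrightarrow> fps_to_fls (g :: 'a::group_add fps)) F"
proof -
  have "dist (fps_to_fls f) (fps_to_fls g) = dist f g" for f g :: "'a fps"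
  proof (cases "f = g")
    case False
    then show ?thesis
      by (simp add: dist_fls_def dist_fps_def fls_subdegree_fls_to_fps flip: fps_to_fls_minus)
  qed simp
  with assms show ?thesis by (simp add: tendsto_iff)
qed

section \<open>Truncations of the character\<close>

lemma fps_agree_basic_character_prod:
  assumes "d \<le> M"
  shows "fps_agree d (qpoch_inv M ^ (n - 1)) (prodinf (\<lambda>m. euler_factor (m + 1) ^ (n - 1)))"
proof -
  define f where "f m = euler_factor (m + 1) ^ (n - 1)" for m
  \<comment> \<open>Coefficient \<open>d\<close> is already final in
    \<open>qpoch_inv d ^ (n - 1)\<close>, so the limit is read off the diagonal.\<close>
  define p where "p = Abs_fps (\<lambda>d. fps_nth (qpoch_inv d ^ (n - 1) :: (weight \<Rightarrow>\<^sub>0 int) fps) d)"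
  have prod_f: "(\<Prod>i\<le>N. f i) = qpoch_inv (Suc N) ^ (n - 1)" for N
    by (simp add: f_def euler_factor_def qpoch_inv_def prod_power_distrib lessThan_Suc_atMost)
  have p: "fps_agree d (qpoch_inv M ^ (n - 1)) p" if "d \<le> M" for d M
    unfolding fps_agree_def
  proof safe
    fix i assume "i \<le> d"
    then have "fps_agree i (qpoch_inv M ^ (n - 1)) (qpoch_inv i ^ (n - 1) :: (weight \<Rightarrow>\<^sub>0 int) fps)"
      using that by (intro fps_agree_power fps_agree_qpoch_inv) auto
    then show "fps_nth (qpoch_inv M ^ (n - 1)) i = fps_nth p i"
      by (simp add: fps_agree_def p_def)
  qed
  have "(\<lambda>N. \<Prod>i\<le>N. f i) \<longlonglongrightarrow> p"
  proof (rule tendsto_fpsI)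
    fix d
    show "\<forall>\<^sub>F N in sequentially. fps_nth (\<Prod>i\<le>N. f i) d = fps_nth p d"
    proof (rule eventually_sequentiallyI)
      fix N assume "d \<le> N"
      then show "fps_nth (\<Prod>i\<le>N. f i) d = fps_nth p d"
        unfolding prod_f using p[of d "Suc N"] by (simp add: fps_agree_def)
    qed
  qed
  \<comment> \<open>The value of an infinite product has to be a nonzero limit; the constant term
    certifies this.\<close>
  moreover have "fps_nth p 0 = 1" by (simp add: p_def qpoch_inv_def)
  then have "p \<noteq> 0" by auto
  ultimately have "f has_prod p" by (simp add: has_prod_def raw_has_prod_def)
  then have "p = prodinf f" by (rule has_prod_unique)
  then show ?thesis using p[OF assms] by (simp add: f_def[abs_def])
qed

lemma fps_agree_theta_series:
  "fps_agree d (\<Sum>\<gamma> | \<gamma> \<in> root_lattice n \<and> half_norm n \<gamma> \<le> d. fps_X ^ half_norm n \<gamma> * fps_const (x_monomial n \<gamma>))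
     (\<Sum>\<^sub>\<infinity>\<gamma>\<in>root_lattice n. fps_X ^ half_norm n \<gamma> * fps_const (x_monomial n \<gamma>))"
proof -
  define f where "f \<gamma> = fps_X ^ half_norm n \<gamma> * fps_const (x_monomial n \<gamma>)" for \<gamma>
  define B where "B = {\<gamma> \<in> root_lattice n. half_norm n \<gamma> \<le> d}"
  have lim: "(sum f \<longlongrightarrow> infsum f (root_lattice n)) (finite_subsets_at_top (root_lattice n))"
    using has_sum_infsum[OF summable_basic_character] unfolding has_sum_def f_def[abs_def] .
  have "fps_nth (sum f B) i = fps_nth (infsum f (root_lattice n)) i" if i: "i \<le> d" for i
  proof -
    have "\<forall>\<^sub>F Y in finite_subsets_at_top (root_lattice n). fps_nth (sum f Y) i = fps_nth (infsum f (root_lattice n)) i"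
      using lim unfolding tendsto_fps_iff by blast
    \<comment> \<open>Beyond \<open>X\<close> the coefficient \<open>i\<close> is stable. Adjoining
      \<open>B\<close> keeps this, and summands outside \<open>B\<close> have exponent above
      \<open>d\<close>.\<close>
    then obtain X where X: "finite X \<and> X \<subseteq> root_lattice n \<and>
        (\<forall>Y. finite Y \<and> X \<subseteq> Y \<and> Y \<subseteq> root_lattice n \<longrightarrow>
          fps_nth (sum f Y) i = fps_nth (infsum f (root_lattice n)) i)"
      unfolding eventually_finite_subsets_at_top by (elim exE)
    have fin: "finite B" unfolding B_def by (rule finite_half_norm)
    have "fps_nth (sum f (X \<union> B)) i = fps_nth (infsum f (root_lattice n)) i"
      using X[THEN conjunct2, THEN conjunct2, rule_format, of "X \<union> B"] X fin by (auto simp: B_def)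
    moreover have "fps_agree d (sum f (X \<union> B)) (sum f B)"
      unfolding f_def using X fin
      by (intro fps_agree_sum_neutral fps_agree_X_power_mult) (auto simp: B_def)
    ultimately show ?thesis using i by (simp add: fps_agree_def)
  qed
  then show ?thesis by (simp add: fps_agree_def f_def[abs_def] B_def)
qed

section \<open>The limit of the sums over pairs of words\<close>

definition words_sum :: "nat \<Rightarrow> nat \<Rightarrow> (weight \<Rightarrow>\<^sub>0 int) fps" where
  "words_sum n k = (\<Sum>(\<alpha>, \<beta>)\<in>contents n k \<times> contents n k.
       fps_X ^ half_norm n (content_diff n \<alpha> \<beta>) * fps_const (x_monomial n (content_diff n \<alpha> \<beta>)) *
       fps_X ^ (\<Sum>i=2..n. \<alpha> i * \<beta> i) * content_gf n \<alpha> * content_gf n \<beta>)"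

text \<open>Modulo \<open>X^(d+1)\<close> only finitely many differences \<gamma> and bounded
  multiplicities of the letters from 2 on matter, while ones abound for large \<open>k\<close>. What
  survives no longer depends on \<open>k\<close> and factors, for each \<gamma>, into Durfee
  sums.\<close>

lemma fps_agree_words_sum:
  assumes n: "n \<ge> 2"
  shows "\<forall>\<^sub>F k in sequentially. fps_agree d (words_sum n k) (basic_character n)"
proof -
  define B where "B = {\<gamma> \<in> root_lattice n. half_norm n \<gamma> \<le> d}"
  have fin_B: "finite B" unfolding B_def by (rule finite_half_norm)
  \<comment> \<open>For differences in \<open>B\<close> the numbers \<open>\<alpha> i\<close> and
    \<open>\<beta> i\<close> are at most \<open>N - d\<close> apart, so
    \<open>\<alpha> i \<ge> N\<close> forces \<open>\<beta> i \<ge> d\<close>. The same margin is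
    required by \<open>fps_agree_durfee_rectangle\<close>.\<close>
  define N where "N = d + (\<Sum>\<gamma>\<in>B. \<Sum>i=1..n. nat \<bar>\<gamma> i\<bar>)"
  have N: "d + nat \<bar>\<gamma> i\<bar> \<le> N" if "\<gamma> \<in> B" "i \<in> {1..n}" for \<gamma> i
  proof -
    have "nat \<bar>\<gamma> i\<bar> \<le> (\<Sum>i=1..n. nat \<bar>\<gamma> i\<bar>)"
      by (rule member_le_sum[of i "{1..n}" "\<lambda>i. nat \<bar>\<gamma> i\<bar>"]) (use that in auto)
    also have "\<dots> \<le> (\<Sum>\<gamma>\<in>B. \<Sum>i=1..n. nat \<bar>\<gamma> i\<bar>)"
      by (rule member_le_sum[of \<gamma> B "\<lambda>\<gamma>. \<Sum>i=1..n. nat \<bar>\<gamma> i\<bar>"]) (use that fin_B in auto)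
    finally show ?thesis by (simp add: N_def)
  qed
  define R where "R \<gamma> i = {m. m \<le> N \<and> 0 \<le> int m + \<gamma> i}" for \<gamma> :: "nat \<Rightarrow> int" and i :: nat
  define x where "x \<gamma> = fps_X ^ half_norm n \<gamma> * fps_const (x_monomial n \<gamma>)" for \<gamma>
  define t where "t m l = fps_X ^ (m * l) * (qpoch_inv m * qpoch_inv l :: (weight \<Rightarrow>\<^sub>0 int) fps)"
    for m l :: nat
  have interval: "{1..n} = insert 1 {2..n}" using n by auto
  \<comment> \<open>\<open>I k\<close> holds the pairs of contents that survive; \<open>J\<close>
    parametrizes them without reference to \<open>k\<close>, by the difference and the
    multiplicities in \<alpha> of the letters from 2 on.\<close>
  define I where "I k = {(\<alpha>, \<beta>) \<in> contents n k \<times> contents n k. content_diff n \<alpha> \<beta> \<in> B \<and> (\<forall>i\<in>{2..n}. \<alpha> i \<le> N)}" for k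
  define J where "J = (SIGMA \<gamma>:B. PiE {2..n} (R \<gamma>))"
  have R_fin: "finite (R \<gamma> i)" for \<gamma> i by (simp add: R_def)
  \<comment> \<open>The letters from 2 on take up at most \<open>n * N\<close> positions, which
    leaves at least \<open>N\<close> ones.\<close>
  have large: "fps_agree d (words_sum n k) (basic_character n)" if k: "k \<ge> n * N + N" for k
  proof -
    have first_large: "N \<le> \<alpha> 1" if "\<alpha> \<in> contents n k" "\<forall>i\<in>{2..n}. \<alpha> i \<le> N" for \<alpha>
    proof -
      have "sum \<alpha> {2..n} \<le> (\<Sum>i=2..n. N)" using that by (intro sum_mono) auto
      also have "\<dots> \<le> n * N" by simp
      finally have "sum \<alpha> {2..n} \<le> n * N" .
      moreover have "\<alpha> 1 + sum \<alpha> {2..n} = k"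
        using that(1) unfolding contents_def interval by simp
      ultimately show ?thesis using k by linarith
    qed
    have "fps_agree d (words_sum n k) (\<Sum>(\<alpha>, \<beta>)\<in>I k.
       fps_X ^ half_norm n (content_diff n \<alpha> \<beta>) * fps_const (x_monomial n (content_diff n \<alpha> \<beta>)) *
       fps_X ^ (\<Sum>i=2..n. \<alpha> i * \<beta> i) * content_gf n \<alpha> * content_gf n \<beta>)"
      unfolding words_sum_def
    proof (rule fps_agree_sum_neutral, goal_cases)
      case (3 p)
      obtain \<alpha> \<beta> where p: "p = (\<alpha>, \<beta>)" by force
      let ?g = "content_diff n \<alpha> \<beta>"
      have \<alpha>\<beta>: "\<alpha> \<in> contents n k" "\<beta> \<in> contents n k" and notI: "?g \<notin> B \<or> (\<exists>i\<in>{2..n}. N < \<alpha> i)"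
        using 3 by (auto simp: p I_def not_le)
      \<comment> \<open>Either the norm of the difference is too large, or some
        \<open>\<alpha> i > N\<close> forces \<open>\<beta> i > d\<close> and hence a large product
        \<open>\<alpha> i * \<beta> i\<close>.\<close>
      have "d < half_norm n ?g + (\<Sum>i=2..n. \<alpha> i * \<beta> i)"
      proof (cases "?g \<in> B")
        case False
        then show ?thesis using content_diff_root_lattice[OF \<alpha>\<beta>] by (simp add: B_def)
      next
        case True
        then obtain i where i: "i \<in> {2..n}" "N < \<alpha> i" using notI by auto
        have "?g i = int (\<beta> i) - int (\<alpha> i)" using i by (simp add: content_diff_def)
        moreover have "d + nat \<bar>?g i\<bar> \<le> N" using N[OF True, of i] i by simp
        ultimately have "d < \<beta> i" using i by linarith
        also have "\<beta> i \<le> \<alpha> i * \<beta> i" using i by (cases "\<alpha> i") auto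
        also have "\<dots> \<le> (\<Sum>i=2..n. \<alpha> i * \<beta> i)"
          using i by (intro member_le_sum[of i "{2..n}" "\<lambda>i. \<alpha> i * \<beta> i"]) auto
        finally show ?thesis by simp
      qed
      then have "fps_agree d (fps_X ^ (half_norm n ?g + (\<Sum>i=2..n. \<alpha> i * \<beta> i)) *
          (fps_const (x_monomial n ?g) * content_gf n \<alpha> * content_gf n \<beta>)) 0"
        by (rule fps_agree_X_power_mult)
      then show ?case unfolding p by (simp add: power_add mult_ac)
    qed (auto simp: I_def finite_contents)
    also have "fps_agree d \<dots> (\<Sum>(\<alpha>, \<beta>)\<in>I k. x (content_diff n \<alpha> \<beta>) * (\<Prod>i=2..n. t (\<alpha> i) (\<beta> i)))"
    proof (rule fps_agree_sum, clarify)
      fix \<alpha> \<beta> assume "(\<alpha>, \<beta>) \<in> I k"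
      then have \<alpha>\<beta>: "\<alpha> \<in> contents n k" "\<beta> \<in> contents n k" "content_diff n \<alpha> \<beta> \<in> B"
        and \<alpha>: "\<forall>i\<in>{2..n}. \<alpha> i \<le> N" by (auto simp: I_def)
      have "N \<le> \<alpha> 1" using first_large[OF \<alpha>\<beta>(1) \<alpha>] .
      moreover have "content_diff n \<alpha> \<beta> 1 = int (\<beta> 1) - int (\<alpha> 1)" using n by (simp add: content_diff_def)
      moreover have "d + nat \<bar>content_diff n \<alpha> \<beta> 1\<bar> \<le> N" using N[OF \<alpha>\<beta>(3), of 1] n by simp
      ultimately have "d \<le> \<alpha> 1" "d \<le> \<beta> 1" by linarith+
      then have "fps_agree d (x (content_diff n \<alpha> \<beta>) * fps_X ^ (\<Sum>i=2..n. \<alpha> i * \<beta> i) * content_gf n \<alpha> * content_gf n \<beta>)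
         (x (content_diff n \<alpha> \<beta>) * fps_X ^ (\<Sum>i=2..n. \<alpha> i * \<beta> i) * (\<Prod>i=2..n. qpoch_inv (\<alpha> i)) * (\<Prod>i=2..n. qpoch_inv (\<beta> i)))"
        by (intro fps_agree_mult fps_agree_refl 
            fps_agree_content_gf[OF n \<alpha>\<beta>(1)] fps_agree_content_gf[OF n \<alpha>\<beta>(2)])
      also have "x (content_diff n \<alpha> \<beta>) * fps_X ^ (\<Sum>i=2..n. \<alpha> i * \<beta> i) * (\<Prod>i=2..n. qpoch_inv (\<alpha> i)) * (\<Prod>i=2..n. qpoch_inv (\<beta> i)) =
         x (content_diff n \<alpha> \<beta>) * (\<Prod>i=2..n. t (\<alpha> i) (\<beta> i))"
        unfolding t_def prod.distrib power_sum by (simp only: mult_ac)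
      finally show "fps_agree d
         (fps_X ^ half_norm n (content_diff n \<alpha> \<beta>) * fps_const (x_monomial n (content_diff n \<alpha> \<beta>)) *
          fps_X ^ (\<Sum>i=2..n. \<alpha> i * \<beta> i) * content_gf n \<alpha> * content_gf n \<beta>)
         (x (content_diff n \<alpha> \<beta>) * (\<Prod>i=2..n. t (\<alpha> i) (\<beta> i)))"
        unfolding x_def .
    qed
    also have "(\<Sum>(\<alpha>, \<beta>)\<in>I k. x (content_diff n \<alpha> \<beta>) * (\<Prod>i=2..n. t (\<alpha> i) (\<beta> i))) =
       (\<Sum>(\<gamma>, m)\<in>J. x \<gamma> * (\<Prod>i=2..n. t (m i) (nat (int (m i) + \<gamma> i))))"
    proof -
      \<comment> \<open>The length \<open>k\<close> determines the number of ones from the other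
        multiplicities; \<open>A'\<close> then adds \<gamma> to recover the second content.\<close>
      define A where "A m = restrict (m(1 := k - sum m {2..n})) {1..n}" for m :: "nat \<Rightarrow> nat"
      define A' where "A' \<gamma> m = restrict (\<lambda>i. nat (int (A m i) + \<gamma> i)) {1..n}" for \<gamma> m
      have A_rest: "A m i = m i" if "i \<in> {2..n}" for m i
        using that by (auto simp: A_def)
      have A_J: "A m \<in> contents n k \<and> (\<forall>i\<in>{2..n}. A m i \<le> N) \<and> A' \<gamma> m \<in> contents n k \<and> content_diff n (A m) (A' \<gamma> m) = \<gamma>"
        if J: "(\<gamma>, m) \<in> J" for \<gamma> m
      proof -
        have \<gamma>: "\<gamma> \<in> B" and m: "m i \<le> N" "0 \<le> int (m i) + \<gamma> i" if "i \<in> {2..n}" for i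
          using J that by (auto simp: J_def R_def PiE_iff)
        have "sum m {2..n} \<le> (\<Sum>i=2..n. N)" using m by (intro sum_mono) auto
        also have "\<dots> \<le> n * N" by simp
        finally have "sum m {2..n} \<le> k" using k by linarith
        moreover have "sum (A m) {2..n} = sum m {2..n}" by (intro sum.cong) (auto simp: A_rest)
        moreover have "A m 1 = k - sum m {2..n}" using n by (simp add: A_def)
        ultimately have "sum (A m) {1..n} = k" unfolding interval by simp
        then have c: "A m \<in> contents n k" by (simp add: contents_def A_def)
        have le: "\<forall>i\<in>{2..n}. A m i \<le> N" using m A_rest by auto
        have "\<gamma> \<in> B" using J by (simp add: J_def)
        \<comment> \<open>At the letter 1 the surplus of ones outweighs \<open>\<gamma> 1\<close>;
          at the other letters membership in \<open>R\<close> gives the bound.\<close>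
        have nonneg: "0 \<le> int (A m i) + \<gamma> i" if i: "i \<in> {1..n}" for i
        proof (cases "i = 1")
          case True
          then show ?thesis using first_large[OF c le] N[OF \<open>\<gamma> \<in> B\<close> i] by simp
        next
          case False
          then show ?thesis using i m[of i] A_rest[of i m] by auto
        qed
        have "int (sum (A' \<gamma> m) {1..n}) = (\<Sum>i=1..n. int (A m i) + \<gamma> i)"
          unfolding of_nat_sum using nonneg by (intro sum.cong) (auto simp: A'_def)
        also have "\<dots> = int (sum (A m) {1..n}) + sum \<gamma> {1..n}" by (simp add: sum.distrib)
        also have "\<dots> = int k" using \<open>sum (A m) {1..n} = k\<close> \<open>\<gamma> \<in> B\<close> by (simp add: B_def root_lattice_def)
        finally have "sum (A' \<gamma> m) {1..n} = k" by (simp only: of_nat_eq_iff)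
        moreover have "A' \<gamma> m \<in> {1..n} \<rightarrow>\<^sub>E UNIV" by (simp add: A'_def)
        ultimately have "A' \<gamma> m \<in> contents n k" by (simp add: contents_def)
        moreover have "content_diff n (A m) (A' \<gamma> m) = \<gamma>"
        proof
          fix i
          show "content_diff n (A m) (A' \<gamma> m) i = \<gamma> i"
            using nonneg[of i] \<open>\<gamma> \<in> B\<close>
            by (cases "i \<in> {1..n}") (auto simp: content_diff_def A'_def B_def root_lattice_def PiE_iff extensional_def)
        qed
        ultimately show ?thesis using c le by simp
      qed
      have I_J: "content_diff n \<alpha> \<beta> \<in> B \<and> restrict \<alpha> {2..n} \<in> PiE {2..n} (R (content_diff n \<alpha> \<beta>)) \<and>
          A (restrict \<alpha> {2..n}) = \<alpha> \<and> A' (content_diff n \<alpha> \<beta>) (restrict \<alpha> {2..n}) = \<beta>"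
        if I: "(\<alpha>, \<beta>) \<in> I k" for \<alpha> \<beta>
      proof -
        have c: "\<alpha> \<in> contents n k" "\<beta> \<in> contents n k" using I by (auto simp: I_def)
        have A: "A (restrict \<alpha> {2..n}) = \<alpha>"
        proof
          fix i
          have "\<alpha> 1 + sum \<alpha> {2..n} = k" using c(1) unfolding contents_def interval by simp
          then have "\<alpha> 1 = k - sum \<alpha> {2..n}" by linarith
          then show "A (restrict \<alpha> {2..n}) i = \<alpha> i"
            using c(1) by (auto simp: A_def contents_def PiE_iff extensional_def)
        qed
        have "A' (content_diff n \<alpha> \<beta>) (restrict \<alpha> {2..n}) = \<beta>"
        proof
          fix i
          show "A' (content_diff n \<alpha> \<beta>) (restrict \<alpha> {2..n}) i = \<beta> i"
            using c(2) unfolding A'_def A by (auto simp: content_diff_def contents_def PiE_iff extensional_def)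
        qed
        with A I show ?thesis by (auto simp: I_def R_def content_diff_def)
      qed
      show ?thesis
      proof (rule sum.reindex_bij_witness[of _ "\<lambda>(\<gamma>, m). (A m, A' \<gamma> m)"
            "\<lambda>(\<alpha>, \<beta>). (content_diff n \<alpha> \<beta>, restrict \<alpha> {2..n})"], goal_cases)
        case (1 p)
        then show ?case using I_J by (cases p) auto
      next
        case (2 p)
        then show ?case using I_J by (cases p) (auto simp: J_def)
      next
        case (3 p)
        obtain \<gamma> m where p: "p = (\<gamma>, m)" by force
        have "restrict (A m) {2..n} = m"
        proof
          fix i
          show "restrict (A m) {2..n} i = m i"
            using 3 A_rest by (auto simp: p J_def PiE_iff extensional_def)
        qed
        then show ?case using A_J 3 by (simp add: p)
      next
        case (4 p)
        then show ?case using A_J by (cases p) (auto simp: I_def J_def)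
      next
        case (5 p)
        obtain \<alpha> \<beta> where p: "p = (\<alpha>, \<beta>)" by force
        have "(\<Prod>i=2..n. t (restrict \<alpha> {2..n} i) (nat (int (restrict \<alpha> {2..n} i) + content_diff n \<alpha> \<beta> i))) =
            (\<Prod>i=2..n. t (\<alpha> i) (\<beta> i))"
          by (intro prod.cong) (auto simp: content_diff_def)
        then show ?case by (simp add: p)
      qed
    qed
    \<comment> \<open>For fixed \<gamma> the multiplicities vary independently over the sets
      \<open>R \<gamma> i\<close>, so the sum of products is a product of sums.\<close>
    also have "\<dots> = (\<Sum>\<gamma>\<in>B. x \<gamma> * (\<Prod>i=2..n. \<Sum>m\<in>R \<gamma> i. t m (nat (int m + \<gamma> i))))"
      unfolding J_def using fin_B R_fin
      by (subst sum.Sigma[symmetric]) (auto simp: finite_PiE prod_sum_PiE sum_distrib_left)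
    \<comment> \<open>Each of the \<open>n - 1\<close> Durfee sums agrees with the same series,
      whatever \<gamma> is.\<close>
    also have "fps_agree d \<dots> (\<Sum>\<gamma>\<in>B. x \<gamma> * (\<Prod>i=2..n. qpoch_inv d))"
    proof (intro fps_agree_sum fps_agree_mult fps_agree_prod fps_agree_refl)
      fix \<gamma> i assume "\<gamma> \<in> B" "i \<in> {2..n}"
      then show "fps_agree d (\<Sum>m\<in>R \<gamma> i. t m (nat (int m + \<gamma> i))) (qpoch_inv d)"
        unfolding R_def t_def by (intro fps_agree_durfee_rectangle N) auto
    qed
    also have "(\<Sum>\<gamma>\<in>B. x \<gamma> * (\<Prod>i=2..n. qpoch_inv d)) = qpoch_inv d ^ (n - 1) * (\<Sum>\<gamma>\<in>B. x \<gamma>)"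
      by (simp add: sum_distrib_right mult.commute)
    also have "fps_agree d \<dots> (basic_character n)"
      unfolding basic_character_def B_def x_def
      by (intro fps_agree_mult fps_agree_theta_series fps_agree_basic_character_prod) simp
    finally show ?thesis .
  qed
  then show ?thesis by (intro eventually_sequentiallyI[of "n * N + N"])
qed

text \<open>The exponent is an integer expression whose nonnegativity only emerges in
  \<open>pair_exponent_eq\<close>, which is why the series is stated over Laurent series.\<close>

theorem proposition5:
  fixes n :: nat
  assumes "n \<ge> 2"
  shows "(\<lambda>k. \<Sum>F\<in>C_fillings n k.
            fls_const (x_filling n (k_theta n k) F) *
            fls_X_intpow (int k ^ 2 - inv_stat (k_theta n k) F))
         sums fps_to_fls (basic_character n)"
proof -
  have "(\<lambda>k. words_sum n k) \<longlonglongrightarrow> basic_character n"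
  proof (rule tendsto_fpsI)
    fix d
    show "\<forall>\<^sub>F k in sequentially. fps_nth (words_sum n k) d = fps_nth (basic_character n) d"
      using fps_agree_words_sum[OF assms, of d] by eventually_elim (simp add: fps_agree_def)
  qed
  then show ?thesis
    unfolding sums_def_le partial_sum_C_fillings[OF assms] sum_pair_term[OF assms] words_sum_def[symmetric]
    by (rule tendsto_fps_to_fls)
qed

end
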